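(* Let $M\ge2$, $a\in(0,\frac1M)$, and let $F_a$ denote either $f_a:[0,1]^2\to[0,1]^2$ or $g_a=f_{a,\frac1M-a}:[0,1]^3\to[0,1]^3$, equipped with Lebesgue measure ${\rm Leb}$ (which is invariant in both cases). (i) If $a\in(0,\frac1{2M})$, then $(F_a,{\rm Leb})$ is $(\frac{1-Ma}M,\dots,\frac{1-Ma}M,Ma)$-Bernoulli, where $\frac{1-Ma}{M}$ appears $M$ times. (ii) If $a\in(\frac1{2M},\frac1M)$, then $(F_a,{\rm Leb})$ is $(a,\dots,a,1-Ma)$-Bernoulli, where $a$ appears $M$ times.
   Context: Fix an integer $M\ge2$. Maps. For $a\in(0,\frac1M)$, $\tau_a:[0,1]\to[0,1]$ is given by - $\tau_a(x)=\frac{x-(k-1)a}{a}$ on $[(k-1)a,ka)$, $k=1,\dots,M$; - $\tau_a(x)=\frac{x-Ma}{1-Ma}$ on $[Ma,1]$. Put - $\Omega^+_{\alpha_k}=[(k-1)a,ka)\times[0,1]$; - $\Omega^+_{\beta_k}=[Ma,1]\times[\frac{k-1}M,\frac kM)$ for $k\le M-1$; - $\Omega^+_{\beta_M}=[Ma,1]\times[\frac{M-1}M,1]$. $f_a:[0,1]^2\to[0,1]^2$ is given by - $f_a(x_u,x_c)=(\tau_a(x_u),\frac{x_c}M+\frac{k-1}M)$ on $\Omega^+_{\alpha_k}$; - $f_a(x_u,x_c)=(\tau_a(x_u),Mx_c-k+1)$ on $\Omega^+_{\beta_k}$. For $(a,b)\in(0,\frac1M)^2$, with $\Omega_\gamma=\Omega^+_\gamma\times[0,1]$,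 define $f_{a,b}:[0,1]^3\to[0,1]^3$ by - $f_{a,b}(x_u,x_c,x_s)=(f_a(x_u,x_c),(1-Mb)x_s)$ on $\Omega_{\alpha_k}$; - $f_{a,b}(x_u,x_c,x_s)=(f_a(x_u,x_c),bx_s+1+b(k-M-1))$ on $\Omega_{\beta_k}$. Bernoulli. A probability vector $q=(q_1,\dots,q_{M+1})$ with positive entries determines the Bernoulli shift on $\{1,\dots,M+1\}^{\mathbb Z}$ with product measure. An (a.e. invertible) measure-preserving system is $q$-Bernoulli if it is measure-theoretically isomorphic to this two-sided Bernoulli shift. For the non-invertible map $f_a$, "$q$-Bernoulli" is understood in the sense that its natural extension is isomorphic to the two-sided $q$-Bernoulli shift. *)

theory Defs
  imports "HOL-Probability.Probability"
begin

text \<open>Index of the interval [(k-1)a, ka) containing x is k = floor(x/a)+1, i.e. k-1 = floor(x/a).\<close>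
definition tau :: "nat \<Rightarrow> real \<Rightarrow> real \<Rightarrow> real" where
  "tau M a x = (if x < real M * a
      then (x - real_of_int \<lfloor>x / a\<rfloor> * a) / a
      else (x - real M * a) / (1 - real M * a))"

text \<open>For x_u in [Ma,1], index k-1 of the horizontal strip containing x_c:
  [(k-1)/M, k/M) for k \<le> M-1, and [(M-1)/M, 1] for k = M.\<close>
definition beta_idx :: "nat \<Rightarrow> real \<Rightarrow> int" where
  "beta_idx M xc = min \<lfloor>real M * xc\<rfloor> (int M - 1)"

definition fa :: "nat \<Rightarrow> real \<Rightarrow> real \<times> real \<Rightarrow> real \<times> real" where
  "fa M a = (\<lambda>(xu, xc). if xu < real M * a
      then (tau M a xu, xc / real M + real_of_int \<lfloor>xu / a\<rfloor> / real M)
      else (tau M a xu, real M * xc - real_of_int (beta_idx M xc)))"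

definition fab :: "nat \<Rightarrow> real \<Rightarrow> real \<Rightarrow> real \<times> real \<times> real \<Rightarrow> real \<times> real \<times> real" where
  "fab M a b = (\<lambda>(xu, xc, xs). if xu < real M * a
      then (fst (fa M a (xu, xc)), snd (fa M a (xu, xc)), (1 - real M * b) * xs)
      else (fst (fa M a (xu, xc)), snd (fa M a (xu, xc)),
            b * xs + 1 + b * (real_of_int (beta_idx M xc + 1) - real M - 1)))"

definition Leb2 :: "(real \<times> real) measure" where
  "Leb2 = restrict_space lborel ({0..1} \<times> {0..1})"

definition Leb3 :: "(real \<times> real \<times> real) measure" where
  "Leb3 = restrict_space lborel ({0..1} \<times> {0..1} \<times> {0..1})"

definition preserves_measure :: "'a measure \<Rightarrow> ('a \<Rightarrow> 'a) \<Rightarrow> bool" where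
  "preserves_measure X T \<longleftrightarrow> T \<in> measurable X X \<and> distr X X T = X"

definition mp_iso :: "'a measure \<Rightarrow> ('a \<Rightarrow> 'a) \<Rightarrow> 'b measure \<Rightarrow> ('b \<Rightarrow> 'b) \<Rightarrow> bool" where
  "mp_iso X T Y S \<longleftrightarrow> (\<exists>X0 Y0 \<phi>.
     X0 \<in> sets X \<and> emeasure X (space X - X0) = 0 \<and> T ` X0 \<subseteq> X0 \<and>
     Y0 \<in> sets Y \<and> emeasure Y (space Y - Y0) = 0 \<and> S ` Y0 \<subseteq> Y0 \<and>
     bij_betw \<phi> X0 Y0 \<and>
     \<phi> \<in> measurable (restrict_space X X0) (restrict_space Y Y0) \<and>
     the_inv_into X0 \<phi> \<in> measurable (restrict_space Y Y0) (restrict_space X X0) \<and>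
     distr (restrict_space X X0) Y \<phi> = Y \<and>
     (\<forall>x\<in>X0. \<phi> (T x) = S (\<phi> x)))"

definition bernoulli_measure :: "nat \<Rightarrow> (nat \<Rightarrow> real) \<Rightarrow> (int \<Rightarrow> nat) measure" where
  "bernoulli_measure n q = (\<Pi>\<^sub>M i\<in>(UNIV::int set). point_measure {1..n} (\<lambda>k. ennreal (q k)))"

definition left_shift :: "(int \<Rightarrow> 'a) \<Rightarrow> int \<Rightarrow> 'a" where
  "left_shift \<omega> = (\<lambda>i. \<omega> (i + 1))"

definition is_bernoulli :: "'a measure \<Rightarrow> ('a \<Rightarrow> 'a) \<Rightarrow> nat \<Rightarrow> (nat \<Rightarrow> real) \<Rightarrow> bool" where
  "is_bernoulli X T n q \<longleftrightarrow> mp_iso X T (bernoulli_measure n q) left_shift"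

text \<open>Natural extension: space of two-sided orbits, with the sigma-algebra induced from the
  product, and the (unique) measure whose every one-coordinate marginal is the original measure.\<close>
definition orbit_space :: "'a measure \<Rightarrow> ('a \<Rightarrow> 'a) \<Rightarrow> (int \<Rightarrow> 'a) set" where
  "orbit_space X T = {x. (\<forall>n. x n \<in> space X) \<and> (\<forall>n. T (x n) = x (n + 1))}"

definition is_natural_extension :: "'a measure \<Rightarrow> ('a \<Rightarrow> 'a) \<Rightarrow> (int \<Rightarrow> 'a) measure \<Rightarrow> bool" where
  "is_natural_extension X T N \<longleftrightarrow>
     sets N = sets (restrict_space (\<Pi>\<^sub>M i\<in>(UNIV::int set). X) (orbit_space X T)) \<and>
     space N = orbit_space X T \<and>
     (\<forall>k. distr N X (\<lambda>x. x k) = X)"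

definition is_bernoulli_natext :: "'a measure \<Rightarrow> ('a \<Rightarrow> 'a) \<Rightarrow> nat \<Rightarrow> (nat \<Rightarrow> real) \<Rightarrow> bool" where
  "is_bernoulli_natext X T n q \<longleftrightarrow>
     (\<exists>N. is_natural_extension X T N \<and> is_bernoulli N left_shift n q)"

end

theory Submission
  imports Defs
begin

text \<open>
  The central coordinate is a stack of base \<open>M\<close> digits: an \<open>\<alpha>\<close>-step pushes a digit that is
  prescribed by the unstable coordinate, a \<open>\<beta>\<close>-step pops one. Reading off \<open>\<alpha>\<^sub>1, \<dots>, \<alpha>\<^sub>M\<close> or
  \<open>\<beta>\<close> from the unstable coordinate along an orbit gives an i.i.d. sequence with weights
  \<open>(a, \<dots>, a, 1 - M a)\<close>: the future depends on the unstable coordinate alone, and stationarity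
  extends this to all times. If \<open>M a > 1/2\<close>, the stack height drifts upwards, hence it is unbounded
  below in the past, so almost surely every digit in the stack was pushed at some time in the past.
  Therefore the sequence determines the central coordinate, and with it the stable one. If
  \<open>M a < 1/2\<close>, the symmetry \<open>(u, c, s) \<mapsto> (1 - s, 1 - c, 1 - u)\<close> conjugates \<open>g_a\<close> to the inverse
  of \<open>g_b\<close> with \<open>b = 1/M - a\<close>, which exchanges pushes and pops. In both cases the symbol is a
  function of the first two coordinates, so the orbits of \<open>f_a\<close> carry the same code.
\<close>

section \<open>Measurable codings by Bernoulli shifts\<close>

text \<open>The obstacle is that the symbol of a pop does not name the digit it removes. The
  unstable coordinate is read from future symbols by contraction alone, but the central one can be
  recovered only from the past, and only at times since which the stack has never sunk below its
  level then.

  Drift enters only at this point: the code has the product law for every a in (0, 1/M), while the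
  decoder needs unbounded heights. When M a < 1/2, a code for g_a is made from the code with
  parameter b, whose weights b = (1 - M a) / M and 1 - M b = M a are the ones required in that case.

  The map f_a forgets the stable coordinate and is not invertible. Its natural extension is not
  identified with g_a: the measure on two-sided orbits is produced from the Bernoulli measure, by
  decoding every shift of a sequence and projecting, and the way back reads one symbol at each point
  of the orbit. This is why the symbol has to be visible in (u, c), also for the reversed
  code.\<close>

lemma AE_preserves_measure:
  assumes "preserves_measure X T" and P: "AE x in X. P x"
  shows "AE x in X. P (T x)"
proof -
  have T: "T \<in> measurable X X" "distr X X T = X"
    using assms(1) by (auto simp: preserves_measure_def)
  have "AE x in distr X X T. P x"
    using P by (subst T(2))
  then show ?thesis
    by (rule AE_distrD[OF T(1)])
qed

lemma preserves_measure_funpow: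
  assumes "preserves_measure X T"
  shows "preserves_measure X (T ^^ m)"
proof (induction m)
  case 0
  show ?case by (simp add: preserves_measure_def id_def distr_id2)
next
  case (Suc m)
  have T: "T \<in> measurable X X" "distr X X T = X"
    using assms by (auto simp: preserves_measure_def)
  have Tm: "(T ^^ m) \<in> measurable X X" "distr X X (T ^^ m) = X"
    using Suc.IH by (auto simp: preserves_measure_def)
  have "distr X X (T \<circ> T ^^ m) = distr (distr X X (T ^^ m)) X T"
    by (rule distr_distr[symmetric]) (use T Tm in auto)
  also have "\<dots> = X"
    using T Tm by simp
  finally show ?case
    using T Tm by (auto simp: preserves_measure_def o_def intro: measurable_compose)
qed

text \<open>Equality of two sequences is a countable intersection of coordinate equalities, each
  measurable because the symbols are discrete. It makes the sets on which a code inverts its decoder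
  measurable.\<close>

lemma measurable_PiM_coordinate_eq_set:
  fixes f g :: "'a \<Rightarrow> 'i::countable \<Rightarrow> 'b::countable"
  assumes f: "f \<in> measurable X (\<Pi>\<^sub>M i\<in>UNIV. point_measure A p)"
    and g: "g \<in> measurable X (\<Pi>\<^sub>M i\<in>UNIV. point_measure A p)"
  shows "{x \<in> space X. f x = g x} \<in> sets X"
proof -
  have c: "(\<lambda>x. h x i) \<in> measurable X (count_space UNIV)"
    if "h \<in> measurable X (\<Pi>\<^sub>M i\<in>(UNIV::'i set). point_measure A p)" for h :: "'a \<Rightarrow> 'i \<Rightarrow> 'b" and i
  proof -
    have "(\<lambda>x. h x i) \<in> measurable X (point_measure A p)"
      using measurable_compose[OF that measurable_component_singleton[of i]] by simp
    moreover have "(\<lambda>y. y) \<in> measurable (point_measure A p) (count_space UNIV)"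
      by simp
    ultimately show ?thesis
      by (rule measurable_compose)
  qed
  have [measurable]: "(\<lambda>x. f x i) \<in> measurable X (count_space UNIV)"
    "(\<lambda>x. g x i) \<in> measurable X (count_space UNIV)" for i
    using c f g by blast+
  have "{x \<in> space X. \<forall>i. f x i = g x i} \<in> sets X"
    by measurable
  then show ?thesis
    by (simp add: fun_eq_iff)
qed

text \<open>\<open>mp_iso\<close> asks for an honest bijection between invariant sets of full
  measure, while codes are equivariant and invertible only almost everywhere. Discarding a null set
  together with its preimages under all iterates repairs this; \<open>eqset\<close> makes the image
  set measurable, which is not automatic for images of measurable sets.\<close>

lemma mp_isoI:
  assumes pX: "preserves_measure X T"
    and Phi: "\<Phi> \<in> measurable X Y" and Psi: "\<Psi> \<in> measurable Y X"
    and distr: "distr X Y \<Phi> = Y"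
    and inv: "AE x in X. \<Psi> (\<Phi> x) = x"
    and equiv: "AE x in X. \<Phi> (T x) = S (\<Phi> x)"
    and eqset: "{y \<in> space Y. \<Phi> (\<Psi> y) = y} \<in> sets Y"
  shows "mp_iso X T Y S"
proof -
  have "AE x in X. \<Psi> (\<Phi> x) = x \<and> \<Phi> (T x) = S (\<Phi> x)"
    using inv equiv by eventually_elim simp
  then obtain N where N: "N \<in> null_sets X"
      "{x \<in> space X. \<not> (\<Psi> (\<Phi> x) = x \<and> \<Phi> (T x) = S (\<Phi> x))} \<subseteq> N"
    by (rule AE_E3) blast
  have Tm: "T \<in> measurable X X" "(T ^^ m) \<in> measurable X X" for m
    using pX preserves_measure_funpow[OF pX, of m] by (auto simp: preserves_measure_def)
  \<comment> \<open>Removing the points whose forward orbit ever meets \<open>N\<close> makes the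
    set forward invariant. Each \<open>T ^^ m\<close> preserves the measure, so only a countable
    union of null sets is lost.\<close>
  define X0 where "X0 = {x \<in> space X. \<forall>m. (T ^^ m) x \<notin> N}"
  have X0_sets: "X0 \<in> sets X"
  proof -
    have [measurable]: "N \<in> sets X" using N by auto
    have [measurable]: "(T ^^ m) \<in> measurable X X" for m by (rule Tm)
    show ?thesis unfolding X0_def by measurable
  qed
  have "AE x in X. x \<notin> N"
    using N(1) by (rule AE_not_in)
  then have "AE x in X. (T ^^ m) x \<notin> N" for m
    by (rule AE_preserves_measure[OF preserves_measure_funpow[OF pX]])
  then have "AE x in X. \<forall>m. (T ^^ m) x \<notin> N"
    by (simp add: AE_all_countable)
  then have AE_X0: "AE x in X. x \<in> X0"
    using AE_space by eventually_elim (simp add: X0_def)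
  have X0_good: "x \<in> space X" "\<Psi> (\<Phi> x) = x" "\<Phi> (T x) = S (\<Phi> x)" "T x \<in> X0" if "x \<in> X0" for x
  proof -
    have x: "x \<in> space X" "\<And>m. (T ^^ m) x \<notin> N" using that by (auto simp: X0_def)
    from x(2)[of 0] have "x \<notin> N" by simp
    then show "x \<in> space X" "\<Psi> (\<Phi> x) = x" "\<Phi> (T x) = S (\<Phi> x)" using N(2) x(1) by auto
    have "(T ^^ m) (T x) \<notin> N" for m
      using x(2)[of "Suc m"] by (simp add: funpow_swap1)
    then show "T x \<in> X0"
      using x(1) Tm(1) by (auto simp: X0_def dest: measurable_space)
  qed
  \<comment> \<open>This is the image of \<open>X0\<close> under \<Phi>, described through \<Psi> so
    that its measurability follows from preimages.\<close>
  define Y0 where "Y0 = {y \<in> space Y. \<Psi> y \<in> X0 \<and> \<Phi> (\<Psi> y) = y}"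
  have Y0_sets: "Y0 \<in> sets Y"
  proof -
    have "Y0 = (\<Psi> -` X0 \<inter> space Y) \<inter> {y \<in> space Y. \<Phi> (\<Psi> y) = y}"
      by (auto simp: Y0_def)
    then show ?thesis
      using measurable_sets[OF Psi X0_sets] eqset by simp
  qed
  have PhiY0: "\<Phi> x \<in> Y0" if "x \<in> X0" for x
    using X0_good[OF that] that measurable_space[OF Phi] by (auto simp: Y0_def)
  have PhiX0: "\<Phi> ` X0 = Y0"
    using PhiY0 by (force simp: Y0_def image_iff)
  have inj: "inj_on \<Phi> X0"
    by (metis X0_good(2) inj_onI)
  have AE_Y0: "AE y in Y. y \<in> Y0"
  proof -
    have "AE x in X. \<Phi> x \<in> Y0"
      using AE_X0 by eventually_elim (rule PhiY0)
    then have "AE y in distr X Y \<Phi>. y \<in> Y0"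
      using Y0_sets sets.sets_into_space[OF Y0_sets]
      by (subst AE_distr_iff[OF Phi]) (auto simp: Int_absorb1 Collect_conj_eq)
    then show ?thesis by (simp only: distr)
  qed
  have SY0: "S ` Y0 \<subseteq> Y0"
    using PhiX0 X0_good PhiY0 by (metis (no_types, lifting) image_iff image_subsetI)
  have null: "emeasure Z (space Z - Z0) = 0" if "Z0 \<in> sets Z" "AE z in Z. z \<in> Z0" for Z and Z0 :: "'c set"
  proof -
    have "{z \<in> space Z. \<not> z \<in> Z0} = space Z - Z0" by auto
    then show ?thesis
      using AE_iff_measurable[of "space Z - Z0" Z "\<lambda>z. z \<in> Z0"] that by auto
  qed
  have inv_eq: "the_inv_into X0 \<Phi> y = \<Psi> y" if "y \<in> Y0" for y
    using that the_inv_into_f_f[OF inj, of "\<Psi> y"] by (auto simp: Y0_def)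
  have Phi_r: "\<Phi> \<in> measurable (restrict_space X X0) (restrict_space Y Y0)"
    using PhiY0 Phi by (intro measurable_restrict_space3) auto
  have Psi_r: "\<Psi> \<in> measurable (restrict_space Y Y0) (restrict_space X X0)"
    using Psi by (intro measurable_restrict_space3) (auto simp: Y0_def)
  have inv_r: "the_inv_into X0 \<Phi> \<in> measurable (restrict_space Y Y0) (restrict_space X X0)"
    using Psi_r by (rule measurable_cong[THEN iffD1, rotated])
      (auto simp: inv_eq space_restrict_space)
  have "distr (restrict_space X X0) Y \<Phi> = distr X Y \<Phi>"
  proof (rule measure_eqI)
    fix A assume "A \<in> sets (distr (restrict_space X X0) Y \<Phi>)"
    then have A: "A \<in> sets Y" by simp
    have Phi': "\<Phi> \<in> measurable (restrict_space X X0) Y"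
      using Phi by (rule measurable_restrict_space1)
    have "emeasure (distr (restrict_space X X0) Y \<Phi>) A
        = emeasure (restrict_space X X0) (\<Phi> -` A \<inter> X0)"
      using X0_sets sets.sets_into_space[OF X0_sets]
      by (simp add: emeasure_distr[OF Phi' A] space_restrict_space Int_absorb1)
    also have "\<dots> = emeasure X (\<Phi> -` A \<inter> X0)"
      using X0_sets by (intro emeasure_restrict_space) auto
    also have "\<dots> = emeasure X (\<Phi> -` A \<inter> space X)"
    proof (rule emeasure_eq_AE)
      show "AE x in X. (x \<in> \<Phi> -` A \<inter> X0) = (x \<in> \<Phi> -` A \<inter> space X)"
        using AE_X0 by eventually_elim (auto simp: X0_def)
      have "\<Phi> -` A \<inter> X0 = (\<Phi> -` A \<inter> space X) \<inter> X0"
        by (auto simp: X0_def)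
      then show "\<Phi> -` A \<inter> X0 \<in> sets X"
        using measurable_sets[OF Phi A] X0_sets by auto
      show "\<Phi> -` A \<inter> space X \<in> sets X"
        using measurable_sets[OF Phi A] .
    qed
    also have "\<dots> = emeasure (distr X Y \<Phi>) A"
      by (simp add: emeasure_distr[OF Phi A])
    finally show "emeasure (distr (restrict_space X X0) Y \<Phi>) A = emeasure (distr X Y \<Phi>) A" .
  qed simp
  then have distr_r: "distr (restrict_space X X0) Y \<Phi> = Y" using distr by simp
  show ?thesis
    unfolding mp_iso_def
    by (rule exI[of _ X0], rule exI[of _ Y0], rule exI[of _ \<Phi>])
      (intro conjI X0_sets Y0_sets null AE_X0 AE_Y0 SY0 Phi_r inv_r distr_r bij_betw_imageI inj PhiX0;
        use X0_good in auto)
qed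

section \<open>Two-sided Bernoulli measures\<close>

locale bernoulli_space =
  fixes n :: nat and q :: "nat \<Rightarrow> real"
  assumes prob_symbol: "prob_space (point_measure {1..n} (\<lambda>k. ennreal (q k)))"
begin

abbreviation "symbol_measure \<equiv> point_measure {1..n} (\<lambda>k. ennreal (q k))"
abbreviation "\<Omega> \<equiv> bernoulli_measure n q"

lemma measurable_Omega_coord: "(\<lambda>\<omega>. \<omega> i) \<in> measurable \<Omega> symbol_measure"
  unfolding bernoulli_measure_def by (rule measurable_component_singleton) simp

lemma measurable_Omega_coord_count [measurable]: "(\<lambda>\<omega>. \<omega> i) \<in> measurable \<Omega> (count_space UNIV)"
  by (rule measurable_compose[OF measurable_Omega_coord]) simp

lemma measurable_OmegaI:
  assumes "\<And>i. (\<lambda>x. f x i) \<in> measurable X symbol_measure"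
  shows "f \<in> measurable X \<Omega>"
  unfolding bernoulli_measure_def
proof (rule measurable_PiM_single')
  show "f \<in> space X \<rightarrow> (\<Pi>\<^sub>E i\<in>UNIV. space symbol_measure)"
    using measurable_space[OF assms] by auto
qed (use assms in simp)

lemma measurable_reindex: "(\<lambda>\<omega> i. \<omega> (\<rho> i)) \<in> measurable \<Omega> \<Omega>"
  by (rule measurable_OmegaI) (rule measurable_Omega_coord)

text \<open>Coordinates are independent with one common law, so an injective relabelling of times
  leaves the measure unchanged. It is applied to translations and to the sign change of
  time.\<close>

lemma Omega_reindex:
  fixes \<rho> :: "int \<Rightarrow> int"
  assumes "inj \<rho>"
  shows "preserves_measure \<Omega> (\<lambda>\<omega> i. \<omega> (\<rho> i))"
  unfolding preserves_measure_def
proof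
  show "(\<lambda>\<omega> i. \<omega> (\<rho> i)) \<in> measurable \<Omega> \<Omega>"
    by (rule measurable_reindex)
  show "distr \<Omega> \<Omega> (\<lambda>\<omega> i. \<omega> (\<rho> i)) = \<Omega>"
    using distr_PiM_reindex[of UNIV "\<lambda>_. symbol_measure" \<rho> UNIV] prob_symbol assms
    by (simp add: bernoulli_measure_def restrict_UNIV)
qed

lemma fixed_set_Omega:
  assumes "f \<in> measurable \<Omega> \<Omega>"
  shows "{\<omega> \<in> space \<Omega>. f \<omega> = \<omega>} \<in> sets \<Omega>"
  using assms measurable_PiM_coordinate_eq_set[of f \<Omega> "{1..n}" "\<lambda>k. ennreal (q k)" "\<lambda>x. x"]
  by (simp add: bernoulli_measure_def measurable_ident_sets)

text \<open>Turns a property of sequences seen from time 0 into the same property seen from every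
  time at once, negative times included.\<close>

lemma AE_Omega_shift:
  assumes "AE \<omega> in \<Omega>. P \<omega>"
  shows "AE \<omega> in \<Omega>. \<forall>k::int. P (\<lambda>i. \<omega> (i + k))"
proof -
  have "AE \<omega> in \<Omega>. P (\<lambda>i. \<omega> (i + k))" for k :: int
    by (rule AE_preserves_measure[OF Omega_reindex[of "\<lambda>i. i + k"] assms]) simp
  then show ?thesis by (simp add: AE_all_countable)
qed

end

text \<open>An isomorphism modulo null sets, presented by two measurable maps that are defined
  everywhere. The second inverse law and the equivariance of \<Psi> are derived:
  \<open>distr_code\<close> carries statements that hold almost everywhere on X over to
  sequences.\<close>

locale bernoulli_code = bernoulli_space n q
  for n q +
  fixes X :: "'a measure" and T :: "'a \<Rightarrow> 'a"
    and \<Phi> :: "'a \<Rightarrow> int \<Rightarrow> nat" and \<Psi> :: "(int \<Rightarrow> nat) \<Rightarrow> 'a"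
  assumes T_preserves: "preserves_measure X T"
    and measurable_code: "\<Phi> \<in> measurable X (bernoulli_measure n q)"
    and measurable_decode: "\<Psi> \<in> measurable (bernoulli_measure n q) X"
    and distr_code: "distr X (bernoulli_measure n q) \<Phi> = bernoulli_measure n q"
    and AE_decode_code: "AE x in X. \<Psi> (\<Phi> x) = x"
    and AE_code_equivariant: "AE x in X. \<Phi> (T x) = left_shift (\<Phi> x)"
begin

lemma is_bernoulli: "is_bernoulli X T n q"
  unfolding is_bernoulli_def
proof (rule mp_isoI[OF T_preserves measurable_code measurable_decode distr_code
      AE_decode_code AE_code_equivariant])
  show "{y \<in> space \<Omega>. \<Phi> (\<Psi> y) = y} \<in> sets \<Omega>"
    by (rule fixed_set_Omega) (rule measurable_compose[OF measurable_decode measurable_code])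
qed

lemma distr_decode: "distr \<Omega> X \<Psi> = X"
proof -
  have "distr \<Omega> X \<Psi> = distr (distr X \<Omega> \<Phi>) X \<Psi>"
    by (simp add: distr_code)
  also have "\<dots> = distr X X (\<lambda>x. \<Psi> (\<Phi> x))"
    using measurable_code measurable_decode by (subst distr_distr) (auto simp: o_def)
  also have "\<dots> = distr X X (\<lambda>x. x)"
    using AE_decode_code measurable_compose[OF measurable_code measurable_decode]
    by (intro distr_cong_AE) auto
  finally show ?thesis by simp
qed

lemma AE_OmegaI:
  assumes "AE x in X. P x"
  shows "AE \<omega> in \<Omega>. P (\<Psi> \<omega>)"
  using assms by (intro AE_distrD[OF measurable_decode]) (simp only: distr_decode)

text \<open>The good set is measurable and contains \<Phi> x for almost every x, and \<Phi> carries
  the measure of X to the Bernoulli measure.\<close>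

lemma AE_code_decode: "AE \<omega> in \<Omega>. \<Phi> (\<Psi> \<omega>) = \<omega>"
proof -
  have m: "{y \<in> space \<Omega>. \<Phi> (\<Psi> y) = y} \<in> sets \<Omega>"
    by (rule fixed_set_Omega) (rule measurable_compose[OF measurable_decode measurable_code])
  have "AE x in X. \<Phi> (\<Psi> (\<Phi> x)) = \<Phi> x"
    using AE_decode_code by eventually_elim simp
  then have "AE \<omega> in distr X \<Omega> \<Phi>. \<Phi> (\<Psi> \<omega>) = \<omega>"
    by (subst AE_distr_iff[OF measurable_code m])
  then show ?thesis by (simp only: distr_code)
qed

lemma AE_decode_equivariant: "AE \<omega> in \<Omega>. \<Psi> (left_shift \<omega>) = T (\<Psi> \<omega>)"
proof -
  have "AE x in X. \<Psi> (\<Phi> (T x)) = T x"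
    by (rule AE_preserves_measure[OF T_preserves AE_decode_code])
  then have "AE x in X. \<Psi> (left_shift (\<Phi> x)) = T x"
    using AE_code_equivariant by eventually_elim simp
  then show ?thesis
    using AE_code_decode AE_OmegaI by (force elim: eventually_elim2)
qed

text \<open>Z is a factor of X whose map \<open>F\<close> may fail to be invertible, but coordinate
  \<open>c\<close> of the code is visible in Z through \<open>s\<close>. By equivariance every
  coordinate can then be read off the two-sided orbit of the projected point, so orbit and sequence
  determine each other.\<close>

lemma natural_extension_is_bernoulli:
  fixes \<pi> :: "'a \<Rightarrow> 'b::{second_countable_topology, t2_space}" and c :: int
  assumes Z_borel: "(\<lambda>z. z) \<in> borel_measurable Z"
    and F: "preserves_measure Z F" and z0: "z0 \<in> space Z" "F z0 = z0"
    and pi: "\<pi> \<in> measurable X Z" "distr X Z \<pi> = Z"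
    and pi_equiv: "AE x in X. \<pi> (T x) = F (\<pi> x)"
    and s: "s \<in> measurable Z (point_measure {1..n} (\<lambda>k. ennreal (q k)))"
    and code_c: "AE x in X. \<Phi> x c = s (\<pi> x)"
  shows "is_bernoulli_natext Z F n q"
proof -
  \<comment> \<open>The point of Z at time i: decode the sequence as seen from time i, then
    project.\<close>
  define orb where "orb \<omega> i = \<pi> (\<Psi> (\<lambda>j. \<omega> (j + i)))" for \<omega> and i :: int
  define legit where "legit \<omega> \<longleftrightarrow> (\<forall>i. F (orb \<omega> i) = orb \<omega> (i + 1))" for \<omega>
  \<comment> \<open>For sequences that are not \<open>legit\<close>, the constant orbit at the fixed
    point \<open>z0\<close> is a default, so that \<open>dec\<close> always lands in the orbit
    space.\<close>
  define dec where "dec \<omega> = (if legit \<omega> then orb \<omega> else (\<lambda>_. z0))" for \<omega>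
  \<comment> \<open>Symbol \<open>c\<close> belongs to the point at time 0, hence symbol i belongs
    to the point at time i - c.\<close>
  define cod where "cod x i = s (x (i - c))" for x :: "int \<Rightarrow> 'b" and i :: int
  define P where "P = restrict_space (\<Pi>\<^sub>M i\<in>(UNIV::int set). Z) (orbit_space Z F)"
  define N where "N = distr \<Omega> P dec"
  have F_meas: "F \<in> measurable Z Z"
    using F by (simp add: preserves_measure_def)
  have orbit_sub: "orbit_space Z F \<subseteq> space (\<Pi>\<^sub>M i\<in>(UNIV::int set). Z)"
    by (auto simp: orbit_space_def space_PiM)
  have space_P: "space P = orbit_space Z F"
    using orbit_sub by (auto simp: P_def space_restrict_space)
  have orb_meas: "(\<lambda>\<omega>. orb \<omega> i) \<in> measurable \<Omega> Z" for i
    unfolding orb_def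
    by (rule measurable_compose[OF measurable_reindex measurable_compose[OF measurable_decode pi(1)]])
  have toborel: "f \<in> borel_measurable A" if "f \<in> measurable A Z" for f and A :: "'c measure"
    using measurable_compose[OF that Z_borel] by simp
  \<comment> \<open>Equality in Z is tested in the Borel sets of a second countable Hausdorff space;
    countably many such equalities define \<open>legit\<close>.\<close>
  have legit_meas: "{\<omega> \<in> space \<Omega>. legit \<omega>} \<in> sets \<Omega>"
  proof -
    have [measurable]: "(\<lambda>\<omega>. F (orb \<omega> i)) \<in> borel_measurable \<Omega>" "(\<lambda>\<omega>. orb \<omega> i) \<in> borel_measurable \<Omega>" for i
      by (intro toborel measurable_compose[OF orb_meas F_meas] orb_meas)+
    show ?thesis
      unfolding legit_def by (intro sets.sets_Collect_countable_All measurable_equality_set) auto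
  qed
  have dec_coord: "(\<lambda>\<omega>. dec \<omega> i) \<in> measurable \<Omega> Z" for i
  proof -
    have "(\<lambda>\<omega>. if legit \<omega> then orb \<omega> i else z0) \<in> measurable \<Omega> Z"
      by (rule measurable_If[OF orb_meas measurable_const[OF z0(1)] legit_meas])
    moreover have "(\<lambda>\<omega>. dec \<omega> i) = (\<lambda>\<omega>. if legit \<omega> then orb \<omega> i else z0)"
      by (auto simp: dec_def)
    ultimately show ?thesis by simp
  qed
  have dec_orbit: "dec \<omega> \<in> orbit_space Z F" if "\<omega> \<in> space \<Omega>" for \<omega>
    using measurable_space[OF orb_meas that] z0 by (auto simp: dec_def orbit_space_def legit_def)
  have dec_meas: "dec \<in> measurable \<Omega> P"
    unfolding P_def
    by (rule measurable_restrict_space2)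
      (use dec_orbit dec_coord z0 measurable_space[OF dec_coord] in
        \<open>auto intro!: measurable_PiM_single' simp: PiE_def extensional_def\<close>)
  have coord_meas: "(\<lambda>x. x k) \<in> measurable P Z" for k
    unfolding P_def by (rule measurable_restrict_space1) (rule measurable_component_singleton, simp)
  have cod_meas: "cod \<in> measurable P \<Omega>"
    unfolding cod_def by (rule measurable_OmegaI) (rule measurable_compose[OF coord_meas s])
  have AE_legit: "AE \<omega> in \<Omega>. legit \<omega>"
  proof -
    have "AE \<omega> in \<Omega>. \<pi> (T (\<Psi> \<omega>)) = F (\<pi> (\<Psi> \<omega>))"
      by (rule AE_OmegaI[OF pi_equiv])
    then have "AE \<omega> in \<Omega>. F (\<pi> (\<Psi> \<omega>)) = \<pi> (\<Psi> (left_shift \<omega>))"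
      using AE_decode_equivariant by eventually_elim simp
    from AE_Omega_shift[OF this] show ?thesis
      by (simp add: legit_def orb_def left_shift_def ac_simps)
  qed
  \<comment> \<open>Legitimacy does not see the origin of time, so \<open>dec\<close> commutes with
    the shift everywhere and not just almost everywhere.\<close>
  have shift_legit: "legit (left_shift \<omega>) \<longleftrightarrow> legit \<omega>" for \<omega>
  proof -
    have o: "orb (left_shift \<omega>) i = orb \<omega> (i + 1)" for i
      by (simp add: orb_def left_shift_def ac_simps)
    show ?thesis
      unfolding legit_def o by (metis diff_add_cancel)
  qed
  have dec_shift: "dec (left_shift \<omega>) = left_shift (dec \<omega>)" for \<omega>
    unfolding dec_def shift_legit by (auto simp: fun_eq_iff left_shift_def orb_def ac_simps)
  have AE_cod_dec: "AE \<omega> in \<Omega>. cod (dec \<omega>) = \<omega>"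
  proof -
    have "AE \<omega> in \<Omega>. \<Phi> (\<Psi> \<omega>) c = s (\<pi> (\<Psi> \<omega>))"
      by (rule AE_OmegaI[OF code_c])
    then have "AE \<omega> in \<Omega>. \<omega> c = s (\<pi> (\<Psi> \<omega>))"
      using AE_code_decode by eventually_elim simp
    from AE_Omega_shift[OF this] AE_legit show ?thesis
    proof eventually_elim
      case (elim \<omega>)
      show ?case
      proof
        fix i
        show "cod (dec \<omega>) i = \<omega> i"
          using elim(1)[rule_format, of "i - c"] elim(2) by (simp add: cod_def dec_def orb_def)
      qed
    qed
  qed
  have sets_N: "sets N = sets P" and space_N: "space N = orbit_space Z F"
    by (simp_all add: N_def space_P)
  have shift_meas: "left_shift \<in> measurable P P"
  proof -
    have "left_shift \<in> measurable P (\<Pi>\<^sub>M i\<in>(UNIV::int set). Z)"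
      using measurable_space[OF coord_meas] coord_meas
      by (intro measurable_PiM_single') (auto simp: left_shift_def PiE_def extensional_def)
    then show ?thesis
      unfolding P_def[symmetric]
      by (subst (2) P_def, intro measurable_restrict_space2)
        (auto simp: space_P orbit_space_def left_shift_def)
  qed
  have "is_natural_extension Z F N"
    unfolding is_natural_extension_def
  proof (intro conjI allI)
    show "sets N = sets (restrict_space (\<Pi>\<^sub>M i\<in>(UNIV::int set). Z) (orbit_space Z F))"
      using sets_N by (simp add: P_def)
    show "space N = orbit_space Z F" by (rule space_N)
    fix k :: int
    have "distr N Z (\<lambda>x. x k) = distr \<Omega> Z (\<lambda>\<omega>. dec \<omega> k)"
      unfolding N_def by (subst distr_distr[OF coord_meas dec_meas]) (simp add: o_def)
    also have "\<dots> = distr \<Omega> Z (\<lambda>\<omega>. orb \<omega> k)"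
      using AE_legit by (intro distr_cong_AE dec_coord orb_meas) (auto simp: dec_def)
    \<comment> \<open>The marginal at time k factors into shift by k, decoding and projection, and
      each factor transports the measure to the right one.\<close>
    also have "\<dots> = distr (distr (distr \<Omega> \<Omega> (\<lambda>\<omega> i. \<omega> (i + k))) X \<Psi>) Z \<pi>"
      by (subst distr_distr[OF measurable_decode measurable_reindex],
          subst distr_distr[OF pi(1) measurable_comp[OF measurable_reindex measurable_decode]])
        (simp add: o_def orb_def)
    also have "distr \<Omega> \<Omega> (\<lambda>\<omega> i. \<omega> (i + k)) = \<Omega>"
      using Omega_reindex[of "\<lambda>i. i + k"] by (simp add: preserves_measure_def)
    finally show "distr N Z (\<lambda>x. x k) = Z"
      by (simp add: distr_decode pi(2))
  qed
  moreover have "mp_iso N left_shift \<Omega> left_shift"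
  proof (rule mp_isoI[where \<Phi>=cod and \<Psi>=dec])
    have shift_Omega: "left_shift \<in> measurable \<Omega> \<Omega>" "distr \<Omega> \<Omega> left_shift = \<Omega>"
      using Omega_reindex[of "\<lambda>i. i + 1"] by (simp_all add: preserves_measure_def left_shift_def[abs_def])
    have "distr N N left_shift = distr N P left_shift"
      by (rule distr_cong) (simp_all add: sets_N)
    also have "\<dots> = distr \<Omega> P (\<lambda>\<omega>. dec (left_shift \<omega>))"
      unfolding N_def by (subst distr_distr[OF shift_meas dec_meas]) (simp add: o_def dec_shift)
    also have "\<dots> = distr (distr \<Omega> \<Omega> left_shift) P dec"
      by (subst distr_distr[OF dec_meas shift_Omega(1)]) (simp add: o_def)
    finally have "distr N N left_shift = N"
      by (simp add: shift_Omega(2) N_def)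
    then show "preserves_measure N left_shift"
      using shift_meas by (simp add: preserves_measure_def measurable_cong_sets[OF sets_N sets_N])
    show "cod \<in> measurable N \<Omega>"
      using cod_meas by (simp add: measurable_cong_sets[OF sets_N refl])
    show "dec \<in> measurable \<Omega> N"
      using dec_meas by (simp add: measurable_cong_sets[OF refl sets_N])
    have "distr N \<Omega> cod = distr \<Omega> \<Omega> (\<lambda>\<omega>. cod (dec \<omega>))"
      unfolding N_def by (subst distr_distr[OF cod_meas dec_meas]) (simp add: o_def)
    also have "\<dots> = distr \<Omega> \<Omega> (\<lambda>\<omega>. \<omega>)"
      using AE_cod_dec measurable_compose[OF dec_meas cod_meas] by (intro distr_cong_AE) auto
    finally show "distr N \<Omega> cod = \<Omega>" by simp
    have eqP: "{x \<in> space P. dec (cod x) = x} \<in> sets P"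
    proof -
      have [measurable]: "(\<lambda>x. dec (cod x) i) \<in> borel_measurable P" "(\<lambda>x. x i) \<in> borel_measurable P" for i
        by (intro toborel measurable_compose[OF cod_meas dec_coord] coord_meas)+
      have "{x \<in> space P. \<forall>i. dec (cod x) i = x i} \<in> sets P"
        by (intro sets.sets_Collect_countable_All measurable_equality_set) auto
      then show ?thesis by (simp add: fun_eq_iff)
    qed
    have "AE \<omega> in \<Omega>. dec (cod (dec \<omega>)) = dec \<omega>"
      using AE_cod_dec by eventually_elim simp
    then show "AE x in N. dec (cod x) = x"
      unfolding N_def by (subst AE_distr_iff[OF dec_meas eqP])
    show "AE x in N. cod (left_shift x) = left_shift (cod x)"
      by (simp add: cod_def left_shift_def fun_eq_iff algebra_simps)
    show "{y \<in> space \<Omega>. cod (dec y) = y} \<in> sets \<Omega>"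
      by (rule fixed_set_Omega) (rule measurable_compose[OF dec_meas cod_meas])
  qed
  ultimately show ?thesis
    unfolding is_bernoulli_natext_def is_bernoulli_def by blast
qed

text \<open>\<open>conj\<close> says that R conjugates T' to the inverse of T, without naming that
  inverse. The T-code of R x, read backwards in time, is therefore a code for T'.\<close>

lemma reversed_code:
  assumes T': "preserves_measure X T'" and R: "preserves_measure X R"
    and RR: "\<And>x. x \<in> space X \<Longrightarrow> R (R x) = x"
    and conj: "AE x in X. T (R (T' x)) = R x"
  shows "bernoulli_code n q X T' (\<lambda>x i. \<Phi> (R x) (- i)) (\<lambda>\<omega>. R (\<Psi> (\<lambda>i. \<omega> (- i))))"
proof (intro bernoulli_code.intro bernoulli_space_axioms bernoulli_code_axioms.intro T')
  have Rm: "R \<in> measurable X X" "distr X X R = X"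
    using R by (auto simp: preserves_measure_def)
  have rev: "(\<lambda>\<omega> i. \<omega> (- i)) \<in> measurable \<Omega> \<Omega>" "distr \<Omega> \<Omega> (\<lambda>\<omega> i. \<omega> (- i)) = \<Omega>"
    using Omega_reindex[of "\<lambda>i. - i"] by (auto simp: preserves_measure_def inj_def)
  show code': "(\<lambda>x i. \<Phi> (R x) (- i)) \<in> measurable X \<Omega>"
    by (rule measurable_compose[OF measurable_compose[OF Rm(1) measurable_code] rev(1)])
  show "(\<lambda>\<omega>. R (\<Psi> (\<lambda>i. \<omega> (- i)))) \<in> measurable \<Omega> X"
    by (rule measurable_compose[OF measurable_compose[OF rev(1) measurable_decode] Rm(1)])
  have "distr X \<Omega> (\<lambda>x i. \<Phi> (R x) (- i)) = distr (distr (distr X X R) \<Omega> \<Phi>) \<Omega> (\<lambda>\<omega> i. \<omega> (- i))"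
    by (subst distr_distr[OF measurable_code Rm(1)],
        subst distr_distr[OF rev(1) measurable_comp[OF Rm(1) measurable_code]]) (simp add: o_def)
  then show "distr X \<Omega> (\<lambda>x i. \<Phi> (R x) (- i)) = \<Omega>"
    by (simp add: Rm(2) distr_code rev(2))
  show "AE x in X. R (\<Psi> (\<lambda>i. \<Phi> (R x) (- (- i)))) = x"
    using AE_preserves_measure[OF R AE_decode_code] AE_space
    by eventually_elim (simp add: RR)
  \<comment> \<open>By \<open>conj\<close> the left side is \<Phi> (R x). So passing from x to T' x
    moves \<Phi> (R x) by one right shift, which becomes a left shift after the sign change of
    time.\<close>
  have "AE x in X. \<Phi> (T (R (T' x))) = left_shift (\<Phi> (R (T' x)))"
    by (rule AE_preserves_measure[OF T' AE_preserves_measure[OF R AE_code_equivariant]])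
  then show "AE x in X. (\<lambda>i. \<Phi> (R (T' x)) (- i)) = left_shift (\<lambda>i. \<Phi> (R x) (- i))"
    using conj by eventually_elim (auto simp: left_shift_def fun_eq_iff)
qed

end

section \<open>Lebesgue measure on the unit square and cube\<close>

abbreviation unit_lebesgue :: "real measure" where
  "unit_lebesgue \<equiv> restrict_space lborel {0..1}"

lemma prob_space_unit_lebesgue: "prob_space unit_lebesgue"
  by (rule prob_spaceI) (simp add: space_restrict_space emeasure_restrict_space)

lemma space_unit_lebesgue: "space unit_lebesgue = {0..1}"
  by (simp add: space_restrict_space)

lemma AE_unit_lebesgue: "AE x in unit_lebesgue. 0 < x \<and> x < 1"
proof -
  have "AE x in lborel. x \<noteq> (0::real) \<and> x \<noteq> 1"
    using AE_lborel_singleton[of "0::real"] AE_lborel_singleton[of "1::real"]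
    by eventually_elim auto
  then show ?thesis
    by (subst AE_restrict_space_iff) auto
qed

text \<open>\<open>Leb2\<close> and \<open>Leb3\<close> are restrictions of Lebesgue measure, while
  Fubini needs products of one-dimensional measures; this identity mediates.\<close>

lemma pair_restrict_space_lborel:
  fixes A :: "'a::euclidean_space set" and B :: "'b::euclidean_space set"
  assumes A: "A \<in> sets borel" and B: "B \<in> sets borel"
  shows "restrict_space lborel A \<Otimes>\<^sub>M restrict_space lborel B = restrict_space lborel (A \<times> B)"
proof (rule pair_measure_eqI)
  have sf: "sigma_finite_measure (restrict_space lborel S)" if "S \<in> sets borel" for S :: "'c::euclidean_space set"
    by (rule sigma_finite_measure_restrict_space) (use that sigma_finite_lborel in auto)
  show "sigma_finite_measure (restrict_space lborel A)" "sigma_finite_measure (restrict_space lborel B)"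
    using A B by (auto intro: sf)
  let ?P = "restrict_space lborel A \<Otimes>\<^sub>M restrict_space lborel B" and ?R = "restrict_space lborel (A \<times> B)"
  have sp: "space ?P = A \<times> B" "space ?R = A \<times> B"
    by (auto simp: space_pair_measure space_restrict_space)
  have "(\<lambda>x. (fst x, snd x)) \<in> measurable ?R ?P"
  proof (rule measurable_Pair)
    have "fst \<in> measurable (lborel :: ('a \<times> 'b) measure) lborel" "snd \<in> measurable (lborel :: ('a \<times> 'b) measure) lborel"
      unfolding lborel_prod[symmetric] by simp_all
    then show "fst \<in> measurable ?R (restrict_space lborel A)" "snd \<in> measurable ?R (restrict_space lborel B)"
      by (auto intro!: measurable_restrict_space3)
  qed
  then have 1: "(\<lambda>x. x) \<in> measurable ?R ?P" by simp
  have 2: "(\<lambda>x. x) \<in> measurable ?P ?R"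
  proof (rule measurable_restrict_space2)
    have "(\<lambda>x. (fst x, snd x)) \<in> measurable ?P (lborel \<Otimes>\<^sub>M lborel)"
      by (intro measurable_Pair measurable_compose[OF measurable_fst] measurable_compose[OF measurable_snd]
          measurable_restrict_space1) simp_all
    then show "(\<lambda>x. x) \<in> measurable ?P lborel" by (simp add: lborel_prod)
  qed (simp add: sp)
  show "sets ?P = sets ?R"
  proof (intro set_eqI iffI)
    fix S
    show "S \<in> sets ?R" if "S \<in> sets ?P"
      using measurable_sets[OF 1 that] sets.sets_into_space[OF that] sp by (simp add: Int_absorb2)
    show "S \<in> sets ?P" if "S \<in> sets ?R"
      using measurable_sets[OF 2 that] sets.sets_into_space[OF that] sp by (simp add: Int_absorb2)
  qed
next
  fix S T assume S: "S \<in> sets (restrict_space lborel A)" and T: "T \<in> sets (restrict_space lborel B)"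
  have S': "S \<in> sets lborel" "S \<subseteq> A" and T': "T \<in> sets lborel" "T \<subseteq> B"
    using S T A B by (auto simp: sets_restrict_space_iff)
  have AB: "A \<times> B \<in> sets lborel" 
    using A B by (simp add: borel_Times)
  have "emeasure lborel (S \<times> T) = emeasure lborel S * emeasure lborel T"
    using S'(1) T'(1) lborel.emeasure_pair_measure_Times[of S lborel T] by (simp add: lborel_prod)
  then show "emeasure (restrict_space lborel A) S * emeasure (restrict_space lborel B) T
      = emeasure (restrict_space lborel (A \<times> B)) (S \<times> T)"
    using S' T' A B AB by (subst (1 2 3) emeasure_restrict_space) auto
qed

lemma Leb2_eq: "Leb2 = unit_lebesgue \<Otimes>\<^sub>M unit_lebesgue"
  by (simp add: Leb2_def pair_restrict_space_lborel)

lemma Leb3_eq: "Leb3 = unit_lebesgue \<Otimes>\<^sub>M (unit_lebesgue \<Otimes>\<^sub>M unit_lebesgue)"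
  by (simp add: Leb3_def pair_restrict_space_lborel borel_Times)

interpretation unit: prob_space unit_lebesgue
  by (rule prob_space_unit_lebesgue)

interpretation unit2: pair_prob_space unit_lebesgue unit_lebesgue ..

interpretation unit3: pair_prob_space unit_lebesgue "unit_lebesgue \<Otimes>\<^sub>M unit_lebesgue" ..

lemma space_Leb2: "space Leb2 = {0..1} \<times> {0..1}"
  by (simp add: Leb2_def space_restrict_space)

lemma nn_integral_Leb3:
  assumes "F \<in> borel_measurable Leb3"
  shows "(\<integral>\<^sup>+x. F x \<partial>Leb3) = (\<integral>\<^sup>+u. \<integral>\<^sup>+c. \<integral>\<^sup>+s. F (u, c, s) \<partial>unit_lebesgue \<partial>unit_lebesgue \<partial>unit_lebesgue)"
proof -
  have [measurable]: "F \<in> borel_measurable (unit_lebesgue \<Otimes>\<^sub>M (unit_lebesgue \<Otimes>\<^sub>M unit_lebesgue))"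
    using assms by (simp add: Leb3_eq)
  have "(\<integral>\<^sup>+x. F x \<partial>Leb3) = (\<integral>\<^sup>+u. \<integral>\<^sup>+y. F (u, y) \<partial>(unit_lebesgue \<Otimes>\<^sub>M unit_lebesgue) \<partial>unit_lebesgue)"
    unfolding Leb3_eq by (rule unit2.P.nn_integral_fst[symmetric]) measurable
  also have "\<dots> = (\<integral>\<^sup>+u. \<integral>\<^sup>+c. \<integral>\<^sup>+s. F (u, c, s) \<partial>unit_lebesgue \<partial>unit_lebesgue \<partial>unit_lebesgue)"
  proof (rule nn_integral_cong)
    fix u assume u: "u \<in> space unit_lebesgue"
    show "(\<integral>\<^sup>+y. F (u, y) \<partial>(unit_lebesgue \<Otimes>\<^sub>M unit_lebesgue))
        = (\<integral>\<^sup>+c. \<integral>\<^sup>+s. F (u, c, s) \<partial>unit_lebesgue \<partial>unit_lebesgue)"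
      by (rule unit.nn_integral_fst[symmetric])
        (rule measurable_compose[OF measurable_Pair1'[OF u]], rule assms[unfolded Leb3_eq])
  qed
  finally show ?thesis .
qed

lemma AE_Leb3:
  "AE x in Leb3. 0 < fst x \<and> fst x < 1 \<and> 0 < fst (snd x) \<and> fst (snd x) < 1
    \<and> 0 < snd (snd x) \<and> snd (snd x) < 1"
  unfolding Leb3_eq
proof (rule unit3.AE_pair_measure)
  have "Measurable.pred (borel :: (real \<times> real \<times> real) measure) (\<lambda>x. 0 < fst x \<and> fst x < 1 \<and> 0 < fst (snd x)
      \<and> fst (snd x) < 1 \<and> 0 < snd (snd x) \<and> snd (snd x) < 1)"
    unfolding borel_prod[symmetric] by measurable
  then have "Measurable.pred Leb3 (\<lambda>x. 0 < fst x \<and> fst x < 1 \<and> 0 < fst (snd x)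
      \<and> fst (snd x) < 1 \<and> 0 < snd (snd x) \<and> snd (snd x) < 1)"
    unfolding Leb3_def by (intro measurable_restrict_space1) simp
  then show "{x \<in> space (unit_lebesgue \<Otimes>\<^sub>M unit_lebesgue \<Otimes>\<^sub>M unit_lebesgue).
      0 < fst x \<and> fst x < 1 \<and> 0 < fst (snd x) \<and> fst (snd x) < 1 \<and> 0 < snd (snd x) \<and> snd (snd x) < 1}
    \<in> sets (unit_lebesgue \<Otimes>\<^sub>M unit_lebesgue \<Otimes>\<^sub>M unit_lebesgue)"
    unfolding Leb3_eq by (rule predE)
  have "AE y in unit_lebesgue \<Otimes>\<^sub>M unit_lebesgue. 0 < fst y \<and> fst y < 1 \<and> 0 < snd y \<and> snd y < 1"
  proof (rule unit2.AE_pair_measure)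
    have "Measurable.pred (borel :: (real \<times> real) measure) (\<lambda>y. 0 < fst y \<and> fst y < 1 \<and> 0 < snd y \<and> snd y < 1)"
      unfolding borel_prod[symmetric] by measurable
    then have "Measurable.pred Leb2 (\<lambda>y. 0 < fst y \<and> fst y < 1 \<and> 0 < snd y \<and> snd y < 1)"
      unfolding Leb2_def by (intro measurable_restrict_space1) simp
    then show "{y \<in> space (unit_lebesgue \<Otimes>\<^sub>M unit_lebesgue). 0 < fst y \<and> fst y < 1 \<and> 0 < snd y \<and> snd y < 1}
        \<in> sets (unit_lebesgue \<Otimes>\<^sub>M unit_lebesgue)"
      unfolding Leb2_eq by (rule predE)
    show "AE u in unit_lebesgue. AE v in unit_lebesgue. 0 < fst (u, v) \<and> fst (u, v) < 1 \<and> 0 < snd (u, v) \<and> snd (u, v) < 1"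
      using AE_unit_lebesgue by eventually_elim (use AE_unit_lebesgue in simp)
  qed
  note 1 = this
  show "AE u in unit_lebesgue. AE y in unit_lebesgue \<Otimes>\<^sub>M unit_lebesgue. 0 < fst (u, y) \<and> fst (u, y) < 1
      \<and> 0 < fst (snd (u, y)) \<and> fst (snd (u, y)) < 1 \<and> 0 < snd (snd (u, y)) \<and> snd (snd (u, y)) < 1"
    using AE_unit_lebesgue by eventually_elim (use 1 in simp)
qed

lemma measurable_Leb3I:
  assumes "f \<in> borel_measurable (borel :: (real \<times> real \<times> real) measure)"
    and "\<And>x. x \<in> {0..1} \<times> {0..1} \<times> {0..1} \<Longrightarrow> f x \<in> {0..1} \<times> {0..1} \<times> {0..1}"
  shows "f \<in> measurable Leb3 Leb3"
  unfolding Leb3_def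
proof (rule measurable_restrict_space3)
  show "f \<in> measurable lborel lborel" using assms(1) by simp
qed (use assms(2) in blast)

lemma measurable_proj_Leb3: "(\<lambda>x. (fst x, fst (snd x))) \<in> measurable Leb3 Leb2"
  unfolding Leb3_eq Leb2_eq by measurable

lemma distr_Leb3_Leb2: "distr Leb3 Leb2 (\<lambda>x. (fst x, fst (snd x))) = Leb2"
proof (rule measure_eqI)
  fix A assume "A \<in> sets (distr Leb3 Leb2 (\<lambda>x. (fst x, fst (snd x))))"
  then have A: "A \<in> sets Leb2" by simp
  note m = measurable_proj_Leb3
  have A'[measurable]: "A \<in> sets (unit_lebesgue \<Otimes>\<^sub>M unit_lebesgue)" using A by (simp add: Leb2_eq)
  have "emeasure (distr Leb3 Leb2 (\<lambda>x. (fst x, fst (snd x)))) A = (\<integral>\<^sup>+y. indicator A y \<partial>distr Leb3 Leb2 (\<lambda>x. (fst x, fst (snd x))))"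
    using A by simp
  also have "\<dots> = (\<integral>\<^sup>+x. indicator A (fst x, fst (snd x)) \<partial>Leb3)"
    by (rule nn_integral_distr[OF m]) (use A in simp)
  also have "\<dots> = (\<integral>\<^sup>+u. \<integral>\<^sup>+c. indicator A (u, c) \<partial>unit_lebesgue \<partial>unit_lebesgue)"
    using unit.emeasure_space_1
    by (subst nn_integral_Leb3) (auto intro!: measurable_compose[OF m] borel_measurable_indicator A)
  also have "\<dots> = (\<integral>\<^sup>+y. indicator A y \<partial>Leb2)"
    unfolding Leb2_eq by (rule unit.nn_integral_fst) simp
  finally show "emeasure (distr Leb3 Leb2 (\<lambda>x. (fst x, fst (snd x)))) A = emeasure Leb2 A"
    using A by simp
qed simp

text \<open>Functions replace sets here so that invariance becomes an identity between iterated
  integrals.\<close>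

lemma preserves_Leb3I:
  assumes T: "T \<in> measurable Leb3 Leb3"
    and I: "\<And>F. F \<in> borel_measurable Leb3 \<Longrightarrow> (\<integral>\<^sup>+x. F (T x) \<partial>Leb3) = (\<integral>\<^sup>+x. F x \<partial>Leb3)"
  shows "preserves_measure Leb3 T"
  unfolding preserves_measure_def
proof (intro conjI T measure_eqI)
  fix A assume "A \<in> sets (distr Leb3 Leb3 T)"
  then have A: "A \<in> sets Leb3" by simp
  have "emeasure (distr Leb3 Leb3 T) A = (\<integral>\<^sup>+x. indicator A x \<partial>distr Leb3 Leb3 T)"
    using A by simp
  also have "\<dots> = (\<integral>\<^sup>+x. indicator A (T x) \<partial>Leb3)"
    by (rule nn_integral_distr[OF T]) (use A in simp)
  also have "\<dots> = (\<integral>\<^sup>+x. indicator A x \<partial>Leb3)"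
    by (rule I) (use A in simp)
  finally show "emeasure (distr Leb3 Leb3 T) A = emeasure Leb3 A"
    using A by simp
qed simp

lemma nn_integral_unit_affine:
  fixes c d :: real
  assumes G: "G \<in> borel_measurable unit_lebesgue" and cd: "0 \<le> c" "c < d" "d \<le> 1"
  shows "(\<integral>\<^sup>+x. G x * indicator {c..d} x \<partial>unit_lebesgue)
    = ennreal (d - c) * (\<integral>\<^sup>+y. G (c + (d - c) * y) \<partial>unit_lebesgue)"
proof -
  \<comment> \<open>Extension by zero makes the substitution rule for the whole line
    applicable.\<close>
  define H where "H x = G x * indicator {0..1} x" for x
  have H[measurable]: "H \<in> borel_measurable borel"
    using G borel_measurable_restrict_space_iff_ennreal[of "{0..1}" lborel G] by (simp add: H_def[abs_def])
  have "(\<integral>\<^sup>+x. G x * indicator {c..d} x \<partial>unit_lebesgue) = (\<integral>\<^sup>+x. H x * indicator {c..d} x \<partial>lborel)"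
    by (subst nn_integral_restrict_space)
      (auto simp: H_def ac_simps intro!: nn_integral_cong split: split_indicator)
  also have "\<dots> = \<bar>d - c\<bar> * (\<integral>\<^sup>+y. H (c + (d - c) * y) * indicator {c..d} (c + (d - c) * y) \<partial>lborel)"
    by (rule nn_integral_real_affine) (use cd in auto)
  also have "(\<integral>\<^sup>+y. H (c + (d - c) * y) * indicator {c..d} (c + (d - c) * y) \<partial>lborel)
      = (\<integral>\<^sup>+y. G (c + (d - c) * y) * indicator {0..1} y \<partial>lborel)"
  proof (rule nn_integral_cong)
    fix y :: real
    have 1: "c + (d - c) * y \<in> {c..d} \<longleftrightarrow> y \<in> {0..1}"
    proof -
      have "c + (d - c) * y \<le> d \<longleftrightarrow> (d - c) * y \<le> (d - c) * 1" by auto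
      then show ?thesis using cd by (simp add: zero_le_mult_iff)
    qed
    then have "c + (d - c) * y \<in> {0..1}" if "y \<in> {0..1}"
      using that cd by auto
    with 1 show "H (c + (d - c) * y) * indicator {c..d} (c + (d - c) * y) = G (c + (d - c) * y) * indicator {0..1} y"
      by (auto simp: H_def split: split_indicator)
  qed
  also have "\<dots> = (\<integral>\<^sup>+y. G (c + (d - c) * y) \<partial>unit_lebesgue)"
    by (subst nn_integral_restrict_space) auto
  finally show ?thesis using cd by simp
qed

lemma nn_integral_unit_split:
  fixes p :: real
  assumes G[measurable]: "G \<in> borel_measurable unit_lebesgue" and p: "0 < p" "p < 1"
  shows "(\<integral>\<^sup>+x. G x \<partial>unit_lebesgue) = ennreal p * (\<integral>\<^sup>+y. G (p * y) \<partial>unit_lebesgue)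
    + ennreal (1 - p) * (\<integral>\<^sup>+y. G (p + (1 - p) * y) \<partial>unit_lebesgue)"
proof -
  have ind[measurable]: "(\<lambda>x. indicator {c..d} x :: ennreal) \<in> borel_measurable unit_lebesgue" for c d :: real
    by (simp add: measurable_restrict_space1)
  have "AE x in lborel. x \<noteq> p" by (rule AE_lborel_singleton)
  then have "AE x in unit_lebesgue. x \<noteq> p" by (subst AE_restrict_space_iff) auto
  then have "AE x in unit_lebesgue. G x = G x * indicator {0..p} x + G x * indicator {p..1} x"
    using AE_space by eventually_elim (auto simp: space_unit_lebesgue split: split_indicator)
  then have "(\<integral>\<^sup>+x. G x \<partial>unit_lebesgue)
      = (\<integral>\<^sup>+x. G x * indicator {0..p} x + G x * indicator {p..1} x \<partial>unit_lebesgue)"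
    by (rule nn_integral_cong_AE)
  also have "\<dots> = (\<integral>\<^sup>+x. G x * indicator {0..p} x \<partial>unit_lebesgue)
      + (\<integral>\<^sup>+x. G x * indicator {p..1} x \<partial>unit_lebesgue)"
    by (rule nn_integral_add) measurable
  finally show ?thesis
    using nn_integral_unit_affine[OF G, of 0 p] nn_integral_unit_affine[OF G, of p 1] p by simp
qed

lemma nn_integral_unit_grid:
  fixes M :: nat
  assumes G[measurable]: "G \<in> borel_measurable unit_lebesgue" and M: "0 < M"
  shows "(\<integral>\<^sup>+x. G x \<partial>unit_lebesgue)
    = (\<Sum>k<M. ennreal (1 / M) * (\<integral>\<^sup>+y. G ((real k + y) / M) \<partial>unit_lebesgue))"
proof -
  have ind[measurable]: "(\<lambda>x. indicator {c..d} x :: ennreal) \<in> borel_measurable unit_lebesgue" for c d :: real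
    by (simp add: measurable_restrict_space1)
  \<comment> \<open>Induction on the number m of strips already covered; neighbouring closed strips
    share only the null point m / M.\<close>
  have "m \<le> M \<Longrightarrow> 0 < m \<Longrightarrow> (\<integral>\<^sup>+x. G x * indicator {0..m / M} x \<partial>unit_lebesgue)
      = (\<Sum>k<m. ennreal (1 / M) * (\<integral>\<^sup>+y. G ((real k + y) / M) \<partial>unit_lebesgue))" for m
  proof (induction m)
    case (Suc m)
    have piece: "(\<integral>\<^sup>+x. G x * indicator {m / M..Suc m / M} x \<partial>unit_lebesgue)
        = ennreal (1 / M) * (\<integral>\<^sup>+y. G ((real m + y) / M) \<partial>unit_lebesgue)"
    proof -
      have "real (Suc m) / M \<le> 1" using Suc.prems M by simp
      moreover have "real (Suc m) / M - m / M = 1 / M" by (simp add: diff_divide_distrib[symmetric])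
      ultimately show ?thesis
        using nn_integral_unit_affine[OF G, of "m / M" "Suc m / M"] M
        by (simp add: add_divide_distrib divide_strict_right_mono)
    qed
    show ?case
    proof (cases "m = 0")
      case True
      then show ?thesis using piece by simp
    next
      case False
      have "AE x in lborel. x \<noteq> m / M" by (rule AE_lborel_singleton)
      then have "AE x in unit_lebesgue. x \<noteq> m / M" by (subst AE_restrict_space_iff) auto
      then have "AE x in unit_lebesgue. G x * indicator {0..Suc m / M} x
          = G x * indicator {0..m / M} x + G x * indicator {m / M..Suc m / M} x"
      proof eventually_elim
        case (elim x)
        have "real m / M \<le> Suc m / M" "0 \<le> real m / M" using M by (simp_all add: divide_right_mono)
        then have "0 \<le> x" if "real m / M \<le> x" using that by linarith
        with elim \<open>real m / M \<le> Suc m / M\<close> show ?case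
          by (auto simp del: of_nat_Suc split: split_indicator)
      qed
      then have "(\<integral>\<^sup>+x. G x * indicator {0..Suc m / M} x \<partial>unit_lebesgue)
          = (\<integral>\<^sup>+x. G x * indicator {0..m / M} x + G x * indicator {m / M..Suc m / M} x \<partial>unit_lebesgue)"
        by (rule nn_integral_cong_AE)
      also have "\<dots> = (\<integral>\<^sup>+x. G x * indicator {0..m / M} x \<partial>unit_lebesgue)
          + (\<integral>\<^sup>+x. G x * indicator {m / M..Suc m / M} x \<partial>unit_lebesgue)"
        by (rule nn_integral_add) measurable
      finally show ?thesis
        using Suc.IH Suc.prems False piece by simp
    qed
  qed simp
  from this[of M] M have "(\<integral>\<^sup>+x. G x * indicator {0..1} x \<partial>unit_lebesgue)
      = (\<Sum>k<M. ennreal (1 / M) * (\<integral>\<^sup>+y. G ((real k + y) / M) \<partial>unit_lebesgue))"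
    by simp
  moreover have "(\<integral>\<^sup>+x. G x * indicator {0..1} x \<partial>unit_lebesgue) = (\<integral>\<^sup>+x. G x \<partial>unit_lebesgue)"
    by (rule nn_integral_cong) (auto simp: space_unit_lebesgue)
  ultimately show ?thesis by simp
qed

section \<open>Invariance of Lebesgue measure under the baker maps\<close>

lemma measurable_affine_unit:
  fixes c l :: real
  assumes "0 \<le> c" "0 \<le> l" "c + l \<le> 1"
  shows "(\<lambda>y. c + l * y) \<in> measurable unit_lebesgue unit_lebesgue"
proof (rule measurable_restrict_space3)
  show "(\<lambda>y. c + l * y) \<in> {0..1} \<rightarrow> {0..1}"
  proof
    fix y :: real assume y: "y \<in> {0..1}"
    have "l * y \<le> l * 1" using assms y by (intro mult_left_mono) auto
    then show "c + l * y \<in> {0..1}" using assms y by auto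
  qed
qed simp

lemma nn_integral_cmult_add_sum:
  fixes p r :: ennreal and f :: "'a \<Rightarrow> ennreal"
  assumes f[measurable]: "f \<in> borel_measurable X" and h: "\<And>j. j < m \<Longrightarrow> h j \<in> borel_measurable X"
  shows "(\<integral>\<^sup>+x. (p * f x + (\<Sum>j<m. r * h j x)) \<partial>X) = p * (\<integral>\<^sup>+x. f x \<partial>X) + (\<Sum>j<m. r * (\<integral>\<^sup>+x. h j x \<partial>X))"
proof -
  have rh: "(\<lambda>x. r * h j x) \<in> borel_measurable X" if "j \<in> {..<m}" for j
    using h that by simp
  have "(\<integral>\<^sup>+x. (p * f x + (\<Sum>j<m. r * h j x)) \<partial>X) = (\<integral>\<^sup>+x. p * f x \<partial>X) + (\<integral>\<^sup>+x. (\<Sum>j<m. r * h j x) \<partial>X)"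
    by (rule nn_integral_add) (use rh in \<open>auto intro: borel_measurable_sum\<close>)
  also have "(\<integral>\<^sup>+x. (\<Sum>j<m. r * h j x) \<partial>X) = (\<Sum>j<m. \<integral>\<^sup>+x. r * h j x \<partial>X)"
    by (rule nn_integral_sum) (rule rh)
  also have "\<dots> = (\<Sum>j<m. r * (\<integral>\<^sup>+x. h j x \<partial>X))"
    by (rule sum.cong) (use h in \<open>auto intro: nn_integral_cmult\<close>)
  also have "(\<integral>\<^sup>+x. p * f x \<partial>X) = p * (\<integral>\<^sup>+x. f x \<partial>X)"
    by (rule nn_integral_cmult) simp
  finally show ?thesis .
qed

locale baker =
  fixes M :: nat and a :: real
  assumes M_ge_2: "2 \<le> M" and a_pos: "0 < a" and a_less: "a < 1 / real M"
begin

text \<open>With this value a push scales the coordinates by 1 / a, 1 / M and M a, and a pop by 1 /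
  (1 - M a), M and b. Both products are 1, so g has Jacobian 1 on every cell.\<close>

definition b :: real where "b = 1 / real M - a"

abbreviation g :: "real \<times> real \<times> real \<Rightarrow> real \<times> real \<times> real" where "g \<equiv> fab M a b"

lemma M_pos: "0 < real M" and Ma_pos: "0 < real M * a" and Ma_less: "real M * a < 1"
  and b_pos: "0 < b" and Mb: "real M * b = 1 - real M * a"
  using M_ge_2 a_pos a_less by (auto simp: b_def field_simps)

text \<open>The coordinates (k, u) on push cells, and (j, c) on pop cells in \<open>g_pop\<close>,
  evaluate all floors, and g is affine on each cell. Digits are counted from 0, so cell k here is
  the one of \<open>\<alpha>\<^sub>k\<^sub>+\<^sub>1\<close>.\<close>

lemma g_push:
  assumes "k < M" "0 \<le> u" "u < 1"
  shows "g (a * (real k + u), c, s) = (u, (real k + c) / real M, real M * a * s)"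
proof -
  have "real k + 1 \<le> real M" using assms(1) by linarith
  then have "real k + u < real M" using assms(3) by linarith
  then have lt: "a * (real k + u) < real M * a"
    using a_pos by (simp add: mult.commute)
  have fl: "\<lfloor>a * (real k + u) / a\<rfloor> = int k"
    using a_pos assms by (intro floor_unique) auto
  have "1 - real M * b = real M * a" using Mb by simp
  moreover have "(a * (real k + u) - real k * a) / a = u"
    using a_pos by (simp add: field_simps)
  ultimately show ?thesis
    using lt fl by (simp add: fab_def fa_def tau_def add_divide_distrib)
qed

lemma g_pop:
  assumes "j < M" "0 \<le> c" "c < 1" "0 \<le> u"
  shows "g (real M * a + (1 - real M * a) * u, (real j + c) / real M, s) = (u, c, real M * a + b * (real j + s))"
proof -
  have nlt: "\<not> real M * a + (1 - real M * a) * u < real M * a"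
    using Ma_less assms(4) by (simp add: not_less)
  have "\<lfloor>real M * ((real j + c) / real M)\<rfloor> = int j"
    using M_pos assms by (intro floor_unique) auto
  then have "beta_idx M ((real j + c) / real M) = int j"
    using assms(1) by (simp add: beta_idx_def)
  moreover have "b * s + 1 + b * (real j + 1 - real M - 1) = real M * a + b * (real j + s)"
    using Mb by (simp add: algebra_simps)
  ultimately show ?thesis
    using nlt M_pos Ma_less by (simp add: fab_def fa_def tau_def)
qed

lemma grid_cases:
  assumes "0 \<le> c" "c < 1"
  obtains j d where "j < M" "0 \<le> d" "d < 1" "c = (real j + d) / real M"
proof -
  define j where "j = nat \<lfloor>real M * c\<rfloor>"
  have "0 \<le> real M * c" "real M * c < real M" using assms M_pos by auto
  then have "j < M" "real j \<le> real M * c" "real M * c < real j + 1"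
    unfolding j_def by (linarith | simp add: floor_less_iff nat_less_iff)+
  then show ?thesis
    using M_pos by (intro that[of j "real M * c - real j"]) auto
qed

lemma split_cases:
  assumes "0 \<le> s" "s < 1"
  obtains t where "0 \<le> t" "t < 1" "s = real M * a * t"
    | t where "0 \<le> t" "t < 1" "s = real M * a + (1 - real M * a) * t"
proof (cases "s < real M * a")
  case True
  then show ?thesis using assms Ma_pos by (intro that(1)[of "s / (real M * a)"]) auto
next
  case False
  then show ?thesis
    using assms Ma_less by (intro that(2)[of "(s - real M * a) / (1 - real M * a)"]) auto
qed

lemma unstable_cases:
  assumes "0 \<le> u" "u < 1"
  obtains k v where "k < M" "0 \<le> v" "v < 1" "u = a * (real k + v)"
    | v where "0 \<le> v" "v < 1" "u = real M * a + (1 - real M * a) * v"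
proof (cases rule: split_cases[OF assms])
  case (1 t)
  obtain j d where "j < M" "0 \<le> d" "d < 1" "t = (real j + d) / real M"
    using grid_cases[OF 1(1,2)] by blast
  then show ?thesis using 1(3) M_pos by (intro that(1)[of j d]) auto
next
  case (2 t)
  then show ?thesis using that(2) by blast
qed

text \<open>The stable coordinate remembers the last step: below M a it was a push, and otherwise
  the cell index j is the digit that was popped. This makes g invertible although a pop erases a
  digit from c.\<close>

lemma stable_cases:
  assumes "0 \<le> s" "s < 1"
  obtains t where "0 \<le> t" "t < 1" "s = real M * a * t"
    | j t where "j < M" "0 \<le> t" "t < 1" "s = real M * a + b * (real j + t)"
proof (cases rule: split_cases[OF assms])
  case (1 t)
  then show ?thesis using that(1) by blast
next
  case (2 t)
  obtain j d where "j < M" "0 \<le> d" "d < 1" "t = (real j + d) / real M"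
    using grid_cases[OF 2(1,2)] by blast
  then show ?thesis using 2(3) M_pos Mb[symmetric] by (intro that(2)[of j d]) auto
qed

lemma g_measurable: "g \<in> measurable Leb3 Leb3"
proof (rule measurable_Leb3I)
  have [measurable]: "(\<lambda>x. real_of_int (beta_idx M x)) \<in> borel_measurable borel"
    unfolding beta_idx_def of_int_min by measurable
  show "g \<in> borel_measurable (borel :: (real \<times> real \<times> real) measure)"
    unfolding fab_def fa_def tau_def borel_prod[symmetric] split_beta' fst_conv snd_conv of_int_add
    by measurable
next
  fix x :: "real \<times> real \<times> real" assume "x \<in> {0..1} \<times> {0..1} \<times> {0..1}"
  then obtain u c s where x: "x = (u, c, s)" and r: "0 \<le> u" "u \<le> 1" "0 \<le> c" "c \<le> 1" "0 \<le> s" "s \<le> 1"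
    by auto
  show "g x \<in> {0..1} \<times> {0..1} \<times> {0..1}"
  proof (cases "u < real M * a")
    case True
    then obtain k v where k: "k < M" "0 \<le> v" "v < 1" "u = a * (real k + v)"
      using unstable_cases[OF r(1)] Ma_less by (smt (verit) mult_nonneg_nonneg)
    have "real k + c \<le> real M" using k(1) r by linarith
    moreover have "real M * a * s \<le> 1"
      using Ma_less Ma_pos r mult_mono[of "real M * a" 1 s 1] by simp
    ultimately show ?thesis
      unfolding x k(4) using k r M_pos Ma_pos by (simp add: g_push)
  next
    case False
    define v where "v = (u - real M * a) / (1 - real M * a)"
    have v: "0 \<le> v" "v \<le> 1"
      using False r Ma_less by (auto simp: v_def)
    have "0 \<le> beta_idx M c" "beta_idx M c \<le> int M - 1" 
      using r M_ge_2 M_pos by (auto simp: beta_idx_def)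
    moreover have "real_of_int (beta_idx M c) \<le> real M * c"
      unfolding beta_idx_def of_int_min by (simp add: min.coboundedI1)
    \<comment> \<open>The cap in \<open>beta_idx\<close> acts only at c = 1, since the last strip is
      closed on top.\<close>
    moreover have "real M * c \<le> real_of_int (beta_idx M c) + 1"
    proof (cases "\<lfloor>real M * c\<rfloor> \<le> int M - 1")
      case True
      then show ?thesis unfolding beta_idx_def by (simp add: min_absorb1)
    next
      case False
      then show ?thesis using r M_pos by (simp add: beta_idx_def)
    qed
    moreover have "0 \<le> b * s + 1 + b * (real_of_int (beta_idx M c + 1) - real M - 1)"
    proof -
      have "0 \<le> real M * a + b * (s + real_of_int (beta_idx M c))"
        using b_pos Ma_pos r \<open>0 \<le> beta_idx M c\<close> by simp
      then show ?thesis using Mb by (simp add: algebra_simps)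
    qed
    moreover have "b * s + 1 + b * (real_of_int (beta_idx M c + 1) - real M - 1) \<le> 1"
    proof -
      have "s + real_of_int (beta_idx M c) - real M \<le> 0"
        using r \<open>beta_idx M c \<le> int M - 1\<close> by linarith
      then have "b * (s + real_of_int (beta_idx M c) - real M) \<le> 0"
        using b_pos by (simp add: mult_nonneg_nonpos)
      then show ?thesis by (simp add: algebra_simps)
    qed
    ultimately show ?thesis
      using False v by (simp add: x fab_def fa_def tau_def v_def[symmetric])
  qed
qed

lemma nn_integral_unstable:
  assumes G: "G \<in> borel_measurable unit_lebesgue"
  shows "(\<integral>\<^sup>+u. G u \<partial>unit_lebesgue) = (\<Sum>k<M. ennreal a * (\<integral>\<^sup>+v. G (a * (real k + v)) \<partial>unit_lebesgue))
    + ennreal (1 - real M * a) * (\<integral>\<^sup>+v. G (real M * a + (1 - real M * a) * v) \<partial>unit_lebesgue)"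
proof -
  have "(\<lambda>y. 0 + (real M * a) * y) \<in> measurable unit_lebesgue unit_lebesgue"
    by (rule measurable_affine_unit) (use Ma_pos Ma_less in auto)
  then have "(\<lambda>y. G (real M * a * y)) \<in> borel_measurable unit_lebesgue"
    using G by (auto intro: measurable_compose)
  from nn_integral_unit_grid[OF this, of M]
  have "(\<integral>\<^sup>+y. G (real M * a * y) \<partial>unit_lebesgue)
      = (\<Sum>k<M. ennreal (1 / M) * (\<integral>\<^sup>+v. G (a * (real k + v)) \<partial>unit_lebesgue))"
    using M_pos by (simp add: mult.commute)
  moreover have "ennreal (real M * a) * (ennreal (1 / M) * z) = ennreal a * z" for z
    using M_pos a_pos by (simp add: mult.assoc[symmetric] ennreal_mult[symmetric])
  ultimately show ?thesis
    using nn_integral_unit_split[OF G Ma_pos Ma_less] by (simp add: sum_distrib_left)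
qed

lemma nn_integral_stable:
  assumes G: "G \<in> borel_measurable unit_lebesgue"
  shows "(\<integral>\<^sup>+s. G s \<partial>unit_lebesgue) = ennreal (real M * a) * (\<integral>\<^sup>+t. G (real M * a * t) \<partial>unit_lebesgue)
    + (\<Sum>j<M. ennreal b * (\<integral>\<^sup>+t. G (real M * a + b * (real j + t)) \<partial>unit_lebesgue))"
proof -
  have "(\<lambda>y. real M * a + (1 - real M * a) * y) \<in> measurable unit_lebesgue unit_lebesgue"
    by (rule measurable_affine_unit) (use Ma_pos Ma_less in auto)
  then have "(\<lambda>y. G (real M * a + (1 - real M * a) * y)) \<in> borel_measurable unit_lebesgue"
    using G by (auto intro: measurable_compose)
  from nn_integral_unit_grid[OF this, of M]
  have "(\<integral>\<^sup>+y. G (real M * a + (1 - real M * a) * y) \<partial>unit_lebesgue)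
      = (\<Sum>k<M. ennreal (1 / M) * (\<integral>\<^sup>+v. G (real M * a + b * (real k + v)) \<partial>unit_lebesgue))"
    using M_pos by (simp add: Mb[symmetric])
  moreover have "ennreal (1 - real M * a) * (ennreal (1 / M) * z) = ennreal b * z" for z
    using M_pos b_pos by (simp add: Mb[symmetric] mult.assoc[symmetric] ennreal_mult[symmetric])
  ultimately show ?thesis
    using nn_integral_unit_split[OF G Ma_pos Ma_less] by (simp add: sum_distrib_left)
qed

text \<open>The integral of F o g is split along the unstable cells, that of F along the stable
  ones. Both become the same combination of integrals over the images of the cells, because M a / M
  = a and (1 - M a) / M = b.\<close>

lemma g_preserves: "preserves_measure Leb3 g"
proof (rule preserves_Leb3I[OF g_measurable])
  fix F :: "real \<times> real \<times> real \<Rightarrow> ennreal" assume F: "F \<in> borel_measurable Leb3"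
  let ?U = unit_lebesgue
  have F'[measurable]: "F \<in> borel_measurable (?U \<Otimes>\<^sub>M ?U \<Otimes>\<^sub>M ?U)"
    using F by (simp add: Leb3_eq)
  have Fg: "(\<lambda>x. F (g x)) \<in> borel_measurable Leb3"
    by (rule measurable_compose[OF g_measurable F])
  then have Fg'[measurable]: "(\<lambda>x. F (g x)) \<in> borel_measurable (?U \<Otimes>\<^sub>M ?U \<Otimes>\<^sub>M ?U)"
    by (simp add: Leb3_eq)
  have [measurable]: "(\<lambda>y. real M * a * y) \<in> measurable ?U ?U"
    using measurable_affine_unit[of 0 "real M * a"] Ma_pos Ma_less by simp
  have [measurable]: "(\<lambda>y. real M * a + (1 - real M * a) * y) \<in> measurable ?U ?U"
    using measurable_affine_unit[of "real M * a" "1 - real M * a"] Ma_pos Ma_less by simp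
  have grid: "(\<lambda>y. (real k + y) / real M) \<in> measurable ?U ?U" if "k < M" for k
  proof -
    have "real k + 1 \<le> real M" using that by linarith
    then have "real k / real M + 1 / real M \<le> 1"
      using M_pos by (simp add: field_simps)
    then show ?thesis
      using measurable_affine_unit[of "real k / M" "1 / M"] by (simp add: add_divide_distrib)
  qed
  have stab: "(\<lambda>y. real M * a + b * (real k + y)) \<in> measurable ?U ?U" if "k < M" for k
  proof -
    have "real k + 1 \<le> real M" using that by linarith
    then have "b * (real k + 1) \<le> b * real M" using b_pos by (intro mult_left_mono) auto
    then have "real M * a + b * real k + b \<le> 1" using Mb by (simp add: algebra_simps)
    then show ?thesis
      using measurable_affine_unit[of "real M * a + b * real k" b] Ma_pos b_pos
      by (simp add: algebra_simps)
  qed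
  \<comment> \<open>\<open>P k\<close> and, on the next line, \<open>Q j\<close> are the averages of
    F over the images of the push cell k and of the pop cell with digit j.\<close>
  define P where "P k = (\<integral>\<^sup>+u. \<integral>\<^sup>+c. \<integral>\<^sup>+s. F (u, (real k + c) / M, real M * a * s) \<partial>?U \<partial>?U \<partial>?U)" for k
  define Q where "Q j = (\<integral>\<^sup>+u. \<integral>\<^sup>+c. \<integral>\<^sup>+s. F (u, c, real M * a + b * (real j + s)) \<partial>?U \<partial>?U \<partial>?U)" for j
  have "(\<integral>\<^sup>+x. F (g x) \<partial>Leb3) = (\<integral>\<^sup>+u. \<integral>\<^sup>+c. \<integral>\<^sup>+s. F (g (u, c, s)) \<partial>?U \<partial>?U \<partial>?U)"
    by (rule nn_integral_Leb3[OF Fg])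
  also have "\<dots> = (\<Sum>k<M. ennreal a * (\<integral>\<^sup>+u. \<integral>\<^sup>+c. \<integral>\<^sup>+s. F (g (a * (real k + u), c, s)) \<partial>?U \<partial>?U \<partial>?U))
    + ennreal (1 - real M * a) * (\<integral>\<^sup>+u. \<integral>\<^sup>+c. \<integral>\<^sup>+s. F (g (real M * a + (1 - real M * a) * u, c, s)) \<partial>?U \<partial>?U \<partial>?U)"
    by (rule nn_integral_unstable) measurable
  also have "(\<Sum>k<M. ennreal a * (\<integral>\<^sup>+u. \<integral>\<^sup>+c. \<integral>\<^sup>+s. F (g (a * (real k + u), c, s)) \<partial>?U \<partial>?U \<partial>?U))
      = (\<Sum>k<M. ennreal a * P k)"
  proof (rule sum.cong[OF refl])
    fix k assume k: "k \<in> {..<M}"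
    have "(\<integral>\<^sup>+u. \<integral>\<^sup>+c. \<integral>\<^sup>+s. F (g (a * (real k + u), c, s)) \<partial>?U \<partial>?U \<partial>?U) = P k"
      unfolding P_def
    proof (rule nn_integral_cong_AE)
      show "AE u in ?U. (\<integral>\<^sup>+c. \<integral>\<^sup>+s. F (g (a * (real k + u), c, s)) \<partial>?U \<partial>?U)
          = (\<integral>\<^sup>+c. \<integral>\<^sup>+s. F (u, (real k + c) / M, real M * a * s) \<partial>?U \<partial>?U)"
        using AE_unit_lebesgue by eventually_elim (use k in \<open>simp add: g_push\<close>)
    qed
    then show "ennreal a * (\<integral>\<^sup>+u. \<integral>\<^sup>+c. \<integral>\<^sup>+s. F (g (a * (real k + u), c, s)) \<partial>?U \<partial>?U \<partial>?U) = ennreal a * P k"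
      by simp
  qed
  also have "(\<integral>\<^sup>+u. \<integral>\<^sup>+c. \<integral>\<^sup>+s. F (g (real M * a + (1 - real M * a) * u, c, s)) \<partial>?U \<partial>?U \<partial>?U)
      = (\<integral>\<^sup>+u. (\<Sum>j<M. ennreal (1 / M) * (\<integral>\<^sup>+c. \<integral>\<^sup>+s. F (u, c, real M * a + b * (real j + s)) \<partial>?U \<partial>?U)) \<partial>?U)"
  proof (rule nn_integral_cong)
    fix u assume u[measurable]: "u \<in> space ?U"
    then have u0: "0 \<le> u" by (simp add: space_unit_lebesgue)
    have uu[measurable]: "real M * a + (1 - real M * a) * u \<in> space ?U"
      by (rule measurable_space[OF _ u]) measurable
    have "(\<integral>\<^sup>+c. \<integral>\<^sup>+s. F (g (real M * a + (1 - real M * a) * u, c, s)) \<partial>?U \<partial>?U)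
      = (\<Sum>j<M. ennreal (1 / M) * (\<integral>\<^sup>+c. \<integral>\<^sup>+s. F (g (real M * a + (1 - real M * a) * u, (real j + c) / M, s)) \<partial>?U \<partial>?U))"
      by (rule nn_integral_unit_grid) (measurable, use M_ge_2 in simp)
    also have "\<dots> = (\<Sum>j<M. ennreal (1 / M) * (\<integral>\<^sup>+c. \<integral>\<^sup>+s. F (u, c, real M * a + b * (real j + s)) \<partial>?U \<partial>?U))"
    proof (rule sum.cong[OF refl])
      fix j assume j: "j \<in> {..<M}"
      have "(\<integral>\<^sup>+c. \<integral>\<^sup>+s. F (g (real M * a + (1 - real M * a) * u, (real j + c) / M, s)) \<partial>?U \<partial>?U)
          = (\<integral>\<^sup>+c. \<integral>\<^sup>+s. F (u, c, real M * a + b * (real j + s)) \<partial>?U \<partial>?U)"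
      proof (rule nn_integral_cong_AE)
        show "AE c in ?U. (\<integral>\<^sup>+s. F (g (real M * a + (1 - real M * a) * u, (real j + c) / M, s)) \<partial>?U)
          = (\<integral>\<^sup>+s. F (u, c, real M * a + b * (real j + s)) \<partial>?U)"
          using AE_unit_lebesgue by eventually_elim (use j u0 in \<open>simp add: g_pop\<close>)
      qed
      then show "ennreal (1 / M) * (\<integral>\<^sup>+c. \<integral>\<^sup>+s. F (g (real M * a + (1 - real M * a) * u, (real j + c) / M, s)) \<partial>?U \<partial>?U)
          = ennreal (1 / M) * (\<integral>\<^sup>+c. \<integral>\<^sup>+s. F (u, c, real M * a + b * (real j + s)) \<partial>?U \<partial>?U)"
        by simp
    qed
    finally show "(\<integral>\<^sup>+c. \<integral>\<^sup>+s. F (g (real M * a + (1 - real M * a) * u, c, s)) \<partial>?U \<partial>?U)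
      = (\<Sum>j<M. ennreal (1 / M) * (\<integral>\<^sup>+c. \<integral>\<^sup>+s. F (u, c, real M * a + b * (real j + s)) \<partial>?U \<partial>?U))" .
  qed
  also have "\<dots> = (\<Sum>j<M. ennreal (1 / M) * Q j)"
  proof (subst nn_integral_sum)
    fix j assume "j \<in> {..<M}"
    then have [measurable]: "(\<lambda>y. real M * a + b * (real j + y)) \<in> measurable ?U ?U"
      by (intro stab) simp
    show "(\<lambda>u. ennreal (1 / M) * (\<integral>\<^sup>+c. \<integral>\<^sup>+s. F (u, c, real M * a + b * (real j + s)) \<partial>?U \<partial>?U)) \<in> borel_measurable ?U"
      by measurable
  next
    have "(\<integral>\<^sup>+u. ennreal (1 / M) * (\<integral>\<^sup>+c. \<integral>\<^sup>+s. F (u, c, real M * a + b * (real j + s)) \<partial>?U \<partial>?U) \<partial>?U) = ennreal (1 / M) * Q j"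
      if "j < M" for j
    proof -
      have [measurable]: "(\<lambda>y. real M * a + b * (real j + y)) \<in> measurable ?U ?U"
        using that by (rule stab)
      show ?thesis unfolding Q_def by (rule nn_integral_cmult) measurable
    qed
    then show "(\<Sum>j<M. \<integral>\<^sup>+u. ennreal (1 / M) * (\<integral>\<^sup>+c. \<integral>\<^sup>+s. F (u, c, real M * a + b * (real j + s)) \<partial>?U \<partial>?U) \<partial>?U)
      = (\<Sum>j<M. ennreal (1 / M) * Q j)"
      by simp
  qed
  finally have lhs: "(\<integral>\<^sup>+x. F (g x) \<partial>Leb3)
      = (\<Sum>k<M. ennreal a * P k) + ennreal (1 - real M * a) * (\<Sum>j<M. ennreal (1 / M) * Q j)" .
  have "(\<integral>\<^sup>+x. F x \<partial>Leb3) = (\<integral>\<^sup>+u. \<integral>\<^sup>+c. \<integral>\<^sup>+s. F (u, c, s) \<partial>?U \<partial>?U \<partial>?U)"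
    by (rule nn_integral_Leb3[OF F])
  also have "\<dots> = (\<integral>\<^sup>+u. \<integral>\<^sup>+c. (ennreal (real M * a) * (\<integral>\<^sup>+s. F (u, c, real M * a * s) \<partial>?U)
      + (\<Sum>j<M. ennreal b * (\<integral>\<^sup>+s. F (u, c, real M * a + b * (real j + s)) \<partial>?U))) \<partial>?U \<partial>?U)"
  proof (intro nn_integral_cong)
    fix u c assume [measurable]: "u \<in> space ?U" "c \<in> space ?U"
    show "(\<integral>\<^sup>+s. F (u, c, s) \<partial>?U) = (ennreal (real M * a) * (\<integral>\<^sup>+s. F (u, c, real M * a * s) \<partial>?U)
      + (\<Sum>j<M. ennreal b * (\<integral>\<^sup>+s. F (u, c, real M * a + b * (real j + s)) \<partial>?U)))"
      by (rule nn_integral_stable) measurable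
  qed
  also have "\<dots> = (\<integral>\<^sup>+u. (ennreal (real M * a) * (\<integral>\<^sup>+c. \<integral>\<^sup>+s. F (u, c, real M * a * s) \<partial>?U \<partial>?U)
      + (\<Sum>j<M. ennreal b * (\<integral>\<^sup>+c. \<integral>\<^sup>+s. F (u, c, real M * a + b * (real j + s)) \<partial>?U \<partial>?U))) \<partial>?U)"
  proof (rule nn_integral_cong)
    fix u assume [measurable]: "u \<in> space ?U"
    have m0: "(\<lambda>c. \<integral>\<^sup>+s. F (u, c, real M * a * s) \<partial>?U) \<in> borel_measurable ?U"
      by measurable
    have m: "(\<lambda>c. \<integral>\<^sup>+s. F (u, c, real M * a + b * (real j + s)) \<partial>?U) \<in> borel_measurable ?U" if "j < M" for j
    proof -
      have [measurable]: "(\<lambda>y. real M * a + b * (real j + y)) \<in> measurable ?U ?U"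
        using that by (rule stab)
      show ?thesis by measurable
    qed
    show "(\<integral>\<^sup>+c. (ennreal (real M * a) * (\<integral>\<^sup>+s. F (u, c, real M * a * s) \<partial>?U)
      + (\<Sum>j<M. ennreal b * (\<integral>\<^sup>+s. F (u, c, real M * a + b * (real j + s)) \<partial>?U))) \<partial>?U)
      = (ennreal (real M * a) * (\<integral>\<^sup>+c. \<integral>\<^sup>+s. F (u, c, real M * a * s) \<partial>?U \<partial>?U)
      + (\<Sum>j<M. ennreal b * (\<integral>\<^sup>+c. \<integral>\<^sup>+s. F (u, c, real M * a + b * (real j + s)) \<partial>?U \<partial>?U)))"
      by (rule nn_integral_cmult_add_sum) (rule m0, rule m)
  qed
  also have "\<dots> = ennreal (real M * a) * (\<integral>\<^sup>+u. \<integral>\<^sup>+c. \<integral>\<^sup>+s. F (u, c, real M * a * s) \<partial>?U \<partial>?U \<partial>?U)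
      + (\<Sum>j<M. ennreal b * Q j)"
  proof -
    have m0: "(\<lambda>u. \<integral>\<^sup>+c. \<integral>\<^sup>+s. F (u, c, real M * a * s) \<partial>?U \<partial>?U) \<in> borel_measurable ?U"
      by measurable
    have m: "(\<lambda>u. \<integral>\<^sup>+c. \<integral>\<^sup>+s. F (u, c, real M * a + b * (real j + s)) \<partial>?U \<partial>?U) \<in> borel_measurable ?U" if "j < M" for j
    proof -
      have [measurable]: "(\<lambda>y. real M * a + b * (real j + y)) \<in> measurable ?U ?U"
        using that by (rule stab)
      show ?thesis by measurable
    qed
    show ?thesis
      unfolding Q_def by (rule nn_integral_cmult_add_sum) (rule m0, rule m)
  qed
  also have "(\<integral>\<^sup>+u. \<integral>\<^sup>+c. \<integral>\<^sup>+s. F (u, c, real M * a * s) \<partial>?U \<partial>?U \<partial>?U)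
      = (\<integral>\<^sup>+u. (\<Sum>k<M. ennreal (1 / M) * (\<integral>\<^sup>+c. \<integral>\<^sup>+s. F (u, (real k + c) / M, real M * a * s) \<partial>?U \<partial>?U)) \<partial>?U)"
  proof (rule nn_integral_cong)
    fix u assume [measurable]: "u \<in> space ?U"
    show "(\<integral>\<^sup>+c. \<integral>\<^sup>+s. F (u, c, real M * a * s) \<partial>?U \<partial>?U)
      = (\<Sum>k<M. ennreal (1 / M) * (\<integral>\<^sup>+c. \<integral>\<^sup>+s. F (u, (real k + c) / M, real M * a * s) \<partial>?U \<partial>?U))"
      by (rule nn_integral_unit_grid) (measurable, use M_ge_2 in simp)
  qed
  also have "\<dots> = (\<Sum>k<M. ennreal (1 / M) * P k)"
  proof -
    have m: "(\<lambda>u. \<integral>\<^sup>+c. \<integral>\<^sup>+s. F (u, (real k + c) / M, real M * a * s) \<partial>?U \<partial>?U) \<in> borel_measurable ?U" if "k < M" for k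
    proof -
      have [measurable]: "(\<lambda>y. (real k + y) / M) \<in> measurable ?U ?U"
        using that by (rule grid)
      show ?thesis by measurable
    qed
    show ?thesis
      unfolding P_def
      using nn_integral_cmult_add_sum[of "\<lambda>_. 0" ?U M "\<lambda>k u. \<integral>\<^sup>+c. \<integral>\<^sup>+s. F (u, (real k + c) / M, real M * a * s) \<partial>?U \<partial>?U" 0] m
      by simp
  qed
  finally have rhs: "(\<integral>\<^sup>+x. F x \<partial>Leb3)
      = ennreal (real M * a) * (\<Sum>k<M. ennreal (1 / M) * P k) + (\<Sum>j<M. ennreal b * Q j)" .
  have "ennreal (1 - real M * a) * (ennreal (1 / M) * z) = ennreal b * z" for z
    using M_pos b_pos by (simp add: Mb[symmetric] mult.assoc[symmetric] ennreal_mult[symmetric])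
  moreover have "ennreal (real M * a) * (ennreal (1 / M) * z) = ennreal a * z" for z
    using M_pos a_pos by (simp add: mult.assoc[symmetric] ennreal_mult[symmetric])
  ultimately show "(\<integral>\<^sup>+x. F (g x) \<partial>Leb3) = (\<integral>\<^sup>+x. F x \<partial>Leb3)"
    unfolding lhs rhs by (simp add: sum_distrib_left)
qed

text \<open>Forgetting the stable coordinate intertwines g with f_a and sends \<open>Leb3\<close> to
  \<open>Leb2\<close>, so invariance descends. The section s = 0 yields measurability.\<close>

lemma fa_preserves: "preserves_measure Leb2 (fa M a)"
proof -
  let ?p = "\<lambda>x::real \<times> real \<times> real. (fst x, fst (snd x))"
  have semi: "fa M a (?p x) = ?p (g x)" for x
    by (cases x) (simp add: fab_def)
  have g: "g \<in> measurable Leb3 Leb3" "distr Leb3 Leb3 g = Leb3"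
    using g_preserves by (auto simp: preserves_measure_def)
  have fa_eq: "fa M a = (\<lambda>y. ?p (g (fst y, snd y, 0)))"
    using semi[of "(fst y, snd y, 0)" for y] by (auto simp: fun_eq_iff)
  have "(\<lambda>y. (fst y, snd y, 0)) \<in> measurable Leb2 Leb3"
    unfolding Leb2_eq Leb3_eq by (auto simp: space_unit_lebesgue)
  from measurable_compose[OF measurable_compose[OF this g(1)] measurable_proj_Leb3]
  have f: "fa M a \<in> measurable Leb2 Leb2"
    unfolding fa_eq by (simp only:)
  have "distr Leb2 Leb2 (fa M a) = distr (distr Leb3 Leb2 ?p) Leb2 (fa M a)"
    by (simp add: distr_Leb3_Leb2)
  also have "\<dots> = distr Leb3 Leb2 (\<lambda>x. ?p (g x))"
    by (subst distr_distr[OF f measurable_proj_Leb3]) (simp add: o_def semi)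
  also have "\<dots> = distr (distr Leb3 Leb3 g) Leb2 ?p"
    by (subst distr_distr[OF measurable_proj_Leb3 g(1)]) (simp add: o_def)
  finally show ?thesis
    using f by (simp add: preserves_measure_def g(2) distr_Leb3_Leb2)
qed

end

section \<open>The push-pop coding\<close>

text \<open>Moves a finite window of integer times to 0, ..., N - 1, filling absent times with the
  factor 1, so that a two-sided cylinder can be treated as a one-sided one.\<close>

lemma prod_int_reindex_nat:
  fixes J :: "int set"
  assumes "finite J"
  obtains m N :: nat where
    "\<And>f :: int \<Rightarrow> ennreal. (\<Prod>i\<in>J. f i) = (\<Prod>n<N. if int n - int m \<in> J then f (int n - int m) else 1)"
proof -
  obtain L where L: "\<And>i. i \<in> J \<Longrightarrow> \<bar>i\<bar> \<le> L"
    using finite_imageI[OF assms, of abs] bdd_above_finite[of "abs ` J"] by (auto simp: bdd_above_def)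
  define m where "m = nat L"
  have m: "- int m \<le> i \<and> i \<le> int m" if "i \<in> J" for i
    using L[OF that] by (auto simp: m_def)
  define N where "N = Suc (2 * m)"
  have "(\<Prod>i\<in>J. f i) = (\<Prod>n<N. if int n - int m \<in> J then f (int n - int m) else 1)" for f :: "int \<Rightarrow> ennreal"
  proof -
    have "(\<Prod>n<N. if int n - int m \<in> J then f (int n - int m) else 1) = (\<Prod>n\<in>{n\<in>{..<N}. int n - int m \<in> J}. f (int n - int m))"
      by (rule prod.inter_filter[symmetric]) simp
    also have "\<dots> = (\<Prod>i\<in>J. f i)"
    proof (rule prod.reindex_bij_witness[where i="\<lambda>i. nat (i + int m)" and j="\<lambda>n. int n - int m"])
      fix i assume i: "i \<in> J"
      show "nat (i + int m) \<in> {n \<in> {..<N}. int n - int m \<in> J}"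
        using m[OF i] i by (auto simp: N_def)
      show "int (nat (i + int m)) - int m = i"
        using m[OF i] by simp
    qed auto
    finally show ?thesis ..
  qed
  then show ?thesis using that by blast
qed

text \<open>Half-open like the cells: on this set g is a bijection with inverse \<open>h\<close>,
  without exceptional points, and its complement in the closed cube is null.\<close>

definition cube :: "(real \<times> real \<times> real) set" where
  "cube = {0..<1} \<times> {0..<1} \<times> {0..<1}"

lemma cube_iff: "(u, c, s) \<in> cube \<longleftrightarrow> 0 \<le> u \<and> u < 1 \<and> 0 \<le> c \<and> c < 1 \<and> 0 \<le> s \<and> s < 1"
  by (auto simp: cube_def)

lemma AE_cube: "AE x in Leb3. x \<in> cube"
  using AE_Leb3 by eventually_elim (auto simp: cube_def mem_Times_iff)

lemma cube_borel: "cube \<in> sets borel"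
  unfolding cube_def by (intro borel_Times) auto

section \<open>The inverse of the baker map\<close>

context baker
begin

text \<open>Off the half-open cube, \<open>h\<close> takes a junk value that keeps it a self-map of the closed cube.\<close>

definition h :: "real \<times> real \<times> real \<Rightarrow> real \<times> real \<times> real" where
  "h = (\<lambda>(u, c, s). if (u, c, s) \<in> cube then
      (if s < real M * a
       then (a * (real_of_int \<lfloor>real M * c\<rfloor> + u), real M * c - real_of_int \<lfloor>real M * c\<rfloor>, s / (real M * a))
       else (real M * a + (1 - real M * a) * u, (real_of_int \<lfloor>(s - real M * a) / b\<rfloor> + c) / real M,
             (s - real M * a) / b - real_of_int \<lfloor>(s - real M * a) / b\<rfloor>))
      else (0, 0, 0))"

lemma grid_less: "k < M \<Longrightarrow> c < 1 \<Longrightarrow> (real k + c) / real M < 1"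
proof -
  assume "k < M" "c < 1"
  then have "real k + 1 \<le> real M" by linarith
  then show ?thesis using \<open>c < 1\<close> M_pos by (simp add: field_simps)
qed

lemma push_less: "k < M \<Longrightarrow> u < 1 \<Longrightarrow> a * (real k + u) < real M * a"
proof -
  assume "k < M" "u < 1"
  then have "real k + u < real M" using grid_less[of k u] M_pos by simp
  then have "a * (real k + u) < a * real M" using a_pos by (rule mult_strict_left_mono)
  then show ?thesis by (simp add: mult.commute)
qed

lemma top_less: "u < 1 \<Longrightarrow> real M * a + (1 - real M * a) * u < 1"
proof -
  assume "u < 1"
  then have "(1 - real M * a) * u < (1 - real M * a) * 1"
    by (rule mult_strict_left_mono) (use Ma_less in simp)
  then show ?thesis by (simp add: algebra_simps)
qed

lemma stable_less: "j < M \<Longrightarrow> s < 1 \<Longrightarrow> real M * a + b * (real j + s) < 1"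
proof -
  assume "j < M" "s < 1"
  then have "real j + 1 \<le> real M" by linarith
  then have "b * (real j + s) < b * real M" using \<open>s < 1\<close> b_pos by (intro mult_strict_left_mono) auto
  then show ?thesis using Mb by (simp add: algebra_simps)
qed

lemma cube_push: "k < M \<Longrightarrow> (u, c, s) \<in> cube \<Longrightarrow> (u, (real k + c) / real M, real M * a * s) \<in> cube"
  using grid_less[of k c] M_pos Ma_pos Ma_less mult_strict_mono[of "real M * a" 1 s 1] by (auto simp: cube_iff)

lemma cube_push': "k < M \<Longrightarrow> (u, c, s) \<in> cube \<Longrightarrow> (a * (real k + u), c, s) \<in> cube"
  using order.strict_trans[OF push_less[of k u] Ma_less] a_pos by (auto simp: cube_iff)

lemma cube_pop: "j < M \<Longrightarrow> (u, c, s) \<in> cube \<Longrightarrow> (u, c, real M * a + b * (real j + s)) \<in> cube"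
  using stable_less[of j s] Ma_pos b_pos by (auto simp: cube_iff)

lemma cube_pop': "j < M \<Longrightarrow> (u, c, s) \<in> cube \<Longrightarrow>
    (real M * a + (1 - real M * a) * u, (real j + c) / real M, s) \<in> cube"
  using grid_less[of j c] top_less[of u] Ma_pos Ma_less by (auto simp: cube_iff)

lemma h_push:
  assumes "k < M" "(u, c, s) \<in> cube"
  shows "h (u, (real k + c) / real M, real M * a * s) = (a * (real k + u), c, s)"
proof -
  have "\<lfloor>real M * ((real k + c) / real M)\<rfloor> = int k"
    using M_pos assms by (intro floor_unique) (auto simp: cube_iff)
  moreover have "real M * a * s < real M * a"
    using mult_strict_left_mono[of s 1 "real M * a"] Ma_pos assms by (simp add: cube_iff)
  ultimately show ?thesis
    using cube_push[OF assms] M_pos a_pos by (simp add: h_def)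
qed

lemma h_pop:
  assumes "j < M" "(u, c, s) \<in> cube"
  shows "h (u, c, real M * a + b * (real j + s)) = (real M * a + (1 - real M * a) * u, (real j + c) / real M, s)"
proof -
  have "\<lfloor>(real M * a + b * (real j + s) - real M * a) / b\<rfloor> = int j"
    using b_pos assms by (intro floor_unique) (auto simp: cube_iff)
  moreover have "\<not> real M * a + b * (real j + s) < real M * a"
    using b_pos assms by (auto simp: cube_iff not_less)
  ultimately show ?thesis
    using cube_pop[OF assms] b_pos by (simp add: h_def)
qed

text \<open>Coordinates adapted to the cell that contains the point;
  \<open>cube_cases_backward\<close> uses the cell it came from. In matching coordinates g and
  \<open>h\<close> are inverse to each other by inspection.\<close>

lemma cube_cases_forward:
  assumes "x \<in> cube"
  obtains (push) k u c s where "k < M" "(u, c, s) \<in> cube" "x = (a * (real k + u), c, s)"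
    | (pop) j u c s where "j < M" "(u, c, s) \<in> cube"
        "x = (real M * a + (1 - real M * a) * u, (real j + c) / real M, s)"
proof -
  obtain u c s where x: "x = (u, c, s)" by (cases x)
  have r: "0 \<le> u" "u < 1" "0 \<le> c" "c < 1" "0 \<le> s" "s < 1" using assms by (auto simp: x cube_iff)
  show ?thesis
  proof (cases rule: unstable_cases[OF r(1,2)])
    case (1 k v)
    then show ?thesis using r x by (intro push[of k v c s]) (auto simp: cube_iff)
  next
    case (2 v)
    obtain j d where "j < M" "0 \<le> d" "d < 1" "c = (real j + d) / real M"
      using grid_cases[OF r(3,4)] by blast
    then show ?thesis using r x 2 by (intro pop[of j v d s]) (auto simp: cube_iff)
  qed
qed

lemma cube_cases_backward:
  assumes "x \<in> cube"
  obtains (push) k u c s where "k < M" "(u, c, s) \<in> cube" "x = (u, (real k + c) / real M, real M * a * s)"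
    | (pop) j u c s where "j < M" "(u, c, s) \<in> cube" "x = (u, c, real M * a + b * (real j + s))"
proof -
  obtain u c s where x: "x = (u, c, s)" by (cases x)
  have r: "0 \<le> u" "u < 1" "0 \<le> c" "c < 1" "0 \<le> s" "s < 1" using assms by (auto simp: x cube_iff)
  show ?thesis
  proof (cases rule: stable_cases[OF r(5,6)])
    case (1 t)
    obtain j d where "j < M" "0 \<le> d" "d < 1" "c = (real j + d) / real M"
      using grid_cases[OF r(3,4)] by blast
    then show ?thesis using r x 1 by (intro push[of j u d t]) (auto simp: cube_iff)
  next
    case (2 j t)
    then show ?thesis using r x by (intro pop[of j u c t]) (auto simp: cube_iff)
  qed
qed

lemma g_push_cube: "k < M \<Longrightarrow> (u, c, s) \<in> cube \<Longrightarrow>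
    g (a * (real k + u), c, s) = (u, (real k + c) / real M, real M * a * s)"
  by (rule g_push) (auto simp: cube_iff)

lemma g_pop_cube: "j < M \<Longrightarrow> (u, c, s) \<in> cube \<Longrightarrow>
    g (real M * a + (1 - real M * a) * u, (real j + c) / real M, s) = (u, c, real M * a + b * (real j + s))"
  by (rule g_pop) (auto simp: cube_iff)

lemma g_cube: "x \<in> cube \<Longrightarrow> g x \<in> cube"
  by (erule cube_cases_forward) (simp_all add: g_push_cube g_pop_cube cube_push cube_pop)

lemma h_g: "x \<in> cube \<Longrightarrow> h (g x) = x"
  by (erule cube_cases_forward) (simp_all add: g_push_cube g_pop_cube h_push h_pop)

lemma h_cube: "x \<in> cube \<Longrightarrow> h x \<in> cube"
  by (erule cube_cases_backward) (simp_all add: h_push h_pop cube_push' cube_pop')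

lemma g_h: "x \<in> cube \<Longrightarrow> g (h x) = x"
  by (erule cube_cases_backward) (simp_all add: g_push_cube g_pop_cube h_push h_pop)

lemma h_measurable: "h \<in> measurable Leb3 Leb3"
proof (rule measurable_Leb3I)
  have [measurable]: "cube \<in> sets (borel \<Otimes>\<^sub>M borel \<Otimes>\<^sub>M borel)"
    unfolding borel_prod by (rule cube_borel)
  show "h \<in> borel_measurable (borel :: (real \<times> real \<times> real) measure)"
    unfolding h_def borel_prod[symmetric] split_beta' by measurable
next
  fix x :: "real \<times> real \<times> real"
  have "h x \<in> cube" if "x \<notin> cube"
    using that by (cases x) (auto simp: h_def cube_iff)
  then have "h x \<in> cube" using h_cube by blast
  then show "h x \<in> {0..1} \<times> {0..1} \<times> {0..1}" by (auto simp: cube_def)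
qed

lemma h_preserves: "preserves_measure Leb3 h"
proof -
  have g: "g \<in> measurable Leb3 Leb3" "distr Leb3 Leb3 g = Leb3"
    using g_preserves by (auto simp: preserves_measure_def)
  have "distr Leb3 Leb3 h = distr (distr Leb3 Leb3 g) Leb3 h" by (simp add: g(2))
  also have "\<dots> = distr Leb3 Leb3 (\<lambda>x. h (g x))"
    by (subst distr_distr[OF h_measurable g(1)]) (simp add: o_def)
  also have "\<dots> = distr Leb3 Leb3 (\<lambda>x. x)"
  proof (rule distr_cong_AE)
    show "AE x in Leb3. h (g x) = x"
      using AE_cube by eventually_elim (rule h_g)
  qed (auto intro: measurable_compose[OF g(1) h_measurable])
  finally show ?thesis using h_measurable by (simp add: preserves_measure_def)
qed

section \<open>Two-sided orbits and their symbols\<close>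

definition orbit :: "int \<Rightarrow> real \<times> real \<times> real \<Rightarrow> real \<times> real \<times> real" where
  "orbit i x = (if 0 \<le> i then (g ^^ nat i) x else (h ^^ nat (- i)) x)"

lemma g_pow_cube: "x \<in> cube \<Longrightarrow> (g ^^ m) x \<in> cube" and h_pow_cube: "x \<in> cube \<Longrightarrow> (h ^^ m) x \<in> cube"
  by (induction m) (auto intro: g_cube h_cube)

lemma orbit_cube: "x \<in> cube \<Longrightarrow> orbit i x \<in> cube"
  by (simp add: orbit_def g_pow_cube h_pow_cube)

lemma orbit_g: "x \<in> cube \<Longrightarrow> orbit i (g x) = orbit (i + 1) x"
proof (cases "0 \<le> i")
  case True
  then have "nat (i + 1) = Suc (nat i)" by simp
  then show ?thesis using True by (simp add: orbit_def funpow_swap1)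
next
  case False
  assume x: "x \<in> cube"
  from False obtain m where m: "nat (- i) = Suc m" "i = - int (Suc m)"
    by (metis not_less int_nat_eq minus_minus neg_0_less_iff_less nat_eq_iff not0_implies_Suc zero_less_nat_eq less_irrefl)
  have "orbit i (g x) = (h ^^ m) (h (g x))"
    using False m by (simp add: orbit_def funpow_swap1)
  also have "\<dots> = orbit (i + 1) x"
    using x m by (cases m) (auto simp: h_g orbit_def nat_add_distrib)
  finally show ?thesis .
qed

lemma orbit_h: "x \<in> cube \<Longrightarrow> orbit i (h x) = orbit (i - 1) x"
  using orbit_g[of "h x" "i - 1"] h_cube[of x] g_h[of x] by simp

lemma orbit_h_pow: "x \<in> cube \<Longrightarrow> orbit i ((h ^^ m) x) = orbit (i - int m) x"
proof (induction m arbitrary: i)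
  case (Suc m)
  then show ?case using orbit_h[OF h_pow_cube[of x m], of i] by (simp add: algebra_simps)
qed simp

lemma orbit_measurable: "orbit i \<in> measurable Leb3 Leb3"
  using preserves_measure_funpow[OF g_preserves] preserves_measure_funpow[OF h_preserves]
  by (cases "0 \<le> i") (simp_all add: orbit_def[abs_def] preserves_measure_def)

text \<open>Symbol k in 1, ..., M announces a push of the digit k - 1, and M + 1 announces a pop.
  The popped digit is not recorded, which keeps the symbol a function of u alone.\<close>

definition symb :: "real \<Rightarrow> nat" where
  "symb u = (if u < real M * a then nat \<lfloor>u / a\<rfloor> + 1 else M + 1)"

definition q :: "nat \<Rightarrow> real" where
  "q k = (if k \<le> M then a else 1 - real M * a)"

lemma symb_push: "k < M \<Longrightarrow> 0 \<le> u \<Longrightarrow> u < 1 \<Longrightarrow> symb (a * (real k + u)) = k + 1"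
proof -
  assume k: "k < M" "0 \<le> u" "u < 1"
  have "\<lfloor>a * (real k + u) / a\<rfloor> = int k"
    using a_pos k by (intro floor_unique) auto
  then show ?thesis using push_less[of k u] k by (simp add: symb_def)
qed

lemma symb_pop: "0 \<le> u \<Longrightarrow> symb (real M * a + (1 - real M * a) * u) = M + 1"
proof -
  assume "0 \<le> u"
  then have "0 \<le> (1 - real M * a) * u" using Ma_less by (intro mult_nonneg_nonneg) auto
  then show ?thesis unfolding symb_def by (subst if_not_P) linarith+
qed

lemma symb_range: "0 \<le> u \<Longrightarrow> symb u \<in> {1..M + 1}"
proof -
  assume u: "0 \<le> u"
  show ?thesis
  proof (cases "u < real M * a")
    case True
    then have "u / a < real M" using a_pos by (simp add: field_simps)
    then have "\<lfloor>u / a\<rfloor> < int M" by (simp add: floor_less_iff)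
    then show ?thesis using True by (simp add: symb_def)
  qed (simp add: symb_def)
qed

lemma prob_symbol: "prob_space (point_measure {1..M + 1} (\<lambda>k. ennreal (q k)))"
proof (rule prob_space_point_measure)
  have "(\<Sum>k\<in>{1..M + 1}. ennreal (q k)) = ennreal (\<Sum>k\<in>{1..M + 1}. q k)"
    using a_pos Ma_less by (intro sum_ennreal) (simp add: q_def)
  also have "(\<Sum>k\<in>{1..M + 1}. q k) = (\<Sum>k\<in>{1..M}. q k) + q (M + 1)"
    by simp
  also have "\<dots> = 1" by (simp add: q_def)
  finally show "(\<Sum>k\<in>{1..M + 1}. ennreal (q k)) = 1" by simp
qed auto

sublocale bernoulli_space "M + 1" q
  by (rule bernoulli_space.intro) (rule prob_symbol)

lemma symb_measurable_borel: "symb \<in> measurable borel (count_space UNIV)"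
proof -
  have "(\<lambda>u. \<lfloor>u / a\<rfloor>) \<in> measurable borel (count_space UNIV)"
    by (rule measurable_compose[OF _ measurable_real_floor]) simp
  then have "(\<lambda>u. nat \<lfloor>u / a\<rfloor> + 1) \<in> measurable borel (count_space UNIV)"
    by (rule measurable_compose) simp
  then show ?thesis
    unfolding symb_def by (intro measurable_If) auto
qed

lemma symb_measurable: "symb \<in> measurable unit_lebesgue symbol_measure"
proof -
  have "symb \<in> measurable unit_lebesgue (count_space UNIV)"
    by (rule measurable_restrict_space1) (simp add: symb_measurable_borel)
  then show ?thesis
    using symb_range by (auto simp: space_unit_lebesgue measurable_count_space_eq2_countable
        sets_point_measure space_point_measure)
qed

definition code :: "real \<times> real \<times> real \<Rightarrow> int \<Rightarrow> nat" where
  "code x i = symb (fst (orbit i x))"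

lemma code_measurable: "code \<in> measurable Leb3 \<Omega>"
proof (rule measurable_OmegaI)
  have "fst \<in> measurable Leb3 unit_lebesgue" unfolding Leb3_eq by simp
  then show "(\<lambda>x. code x i) \<in> measurable Leb3 symbol_measure" for i
    unfolding code_def
    by (intro measurable_compose[OF _ symb_measurable] measurable_compose[OF orbit_measurable])
qed

lemma code_g: "x \<in> cube \<Longrightarrow> code (g x) = left_shift (code x)"
  by (auto simp: code_def left_shift_def orbit_g)

lemma code_h: "x \<in> cube \<Longrightarrow> code (h x) = (\<lambda>i. code x (i - 1))"
  by (auto simp: code_def orbit_h)

lemma code_range: "x \<in> cube \<Longrightarrow> code x i \<in> {1..M + 1}"
  unfolding code_def by (rule symb_range) (use orbit_cube[of x i] in \<open>auto simp: cube_def\<close>)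

section \<open>Independence of the symbols\<close>

lemma fst_g_pow: "fst ((g ^^ m) x) = (tau M a ^^ m) (fst x)"
proof (induction m)
  case (Suc m)
  have "fst (g y) = tau M a (fst y)" for y
    by (cases y) (simp add: fab_def fa_def)
  then show ?case using Suc by simp
qed simp

lemma tau_measurable: "tau M a \<in> measurable unit_lebesgue unit_lebesgue"
proof -
  have 1: "(\<lambda>u. (u, 0, 0)) \<in> measurable unit_lebesgue Leb3"
    unfolding Leb3_eq by (auto simp: space_unit_lebesgue)
  have 2: "fst \<in> measurable Leb3 unit_lebesgue" unfolding Leb3_eq by simp
  have "tau M a = (\<lambda>u. fst (g (u, 0, 0)))"
    by (auto simp: fab_def fa_def)
  then show ?thesis
    using measurable_compose[OF measurable_compose[OF 1 g_measurable] 2] by simp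
qed

lemma tau_pow_measurable: "(tau M a ^^ m) \<in> measurable unit_lebesgue unit_lebesgue"
  by (induction m) (auto simp: o_def intro: measurable_compose[OF _ tau_measurable])

lemma symb_comp_measurable:
  "f \<in> measurable X unit_lebesgue \<Longrightarrow> (\<lambda>x. (w :: nat \<Rightarrow> ennreal) (symb (f x))) \<in> borel_measurable X"
  by (rule measurable_compose[OF _ measurable_compose[OF symb_measurable]]) auto

lemma nn_integral_symbol:
  "(\<integral>\<^sup>+k. w k \<partial>symbol_measure) = (\<Sum>k<M. ennreal a * w (k + 1)) + ennreal (1 - real M * a) * w (M + 1)"
proof -
  have "(\<integral>\<^sup>+k. w k \<partial>symbol_measure) = (\<Sum>k\<in>{1..M + 1}. ennreal (q k) * w k)"
    using a_pos Ma_less by (subst nn_integral_point_measure_finite) (auto simp: q_def mult.commute)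
  also have "\<dots> = (\<Sum>k\<in>{1..M}. ennreal (q k) * w k) + ennreal (q (M + 1)) * w (M + 1)"
    by simp
  also have "(\<Sum>k\<in>{1..M}. ennreal (q k) * w k) = (\<Sum>k<M. ennreal a * w (k + 1))"
    by (rule sum.reindex_bij_witness[where i="\<lambda>k. k + 1" and j="\<lambda>k. k - 1"]) (auto simp: q_def)
  finally show ?thesis by (simp add: q_def)
qed

text \<open>On each branch of \<tau> the first symbol is constant and \<tau> undoes the affine
  parametrisation. One step therefore splits off the factor for \<open>w 0\<close> and leaves the
  same integral with the remaining weights.\<close>

lemma nn_integral_future:
  "(\<integral>\<^sup>+u. (\<Prod>n<N. (w n :: nat \<Rightarrow> ennreal) (symb ((tau M a ^^ n) u))) \<partial>unit_lebesgue) = (\<Prod>n<N. \<integral>\<^sup>+k. w n k \<partial>symbol_measure)"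
proof (induction N arbitrary: w)
  case 0
  show ?case using unit.emeasure_space_1 by simp
next
  case (Suc N)
  let ?F = "\<lambda>u. \<Prod>n<N. w (Suc n) (symb ((tau M a ^^ n) u))"
  have F: "?F \<in> borel_measurable unit_lebesgue"
    by (intro borel_measurable_prod_ennreal symb_comp_measurable tau_pow_measurable)
  have eq: "(\<Prod>n<Suc N. w n (symb ((tau M a ^^ n) u))) = w 0 (symb u) * ?F (tau M a u)" for u
    unfolding prod.lessThan_Suc_shift by (simp add: funpow_swap1)
  have G: "(\<lambda>u. w 0 (symb u) * ?F (tau M a u)) \<in> borel_measurable unit_lebesgue"
  proof (rule borel_measurable_times_ennreal)
    show "(\<lambda>u. w 0 (symb u)) \<in> borel_measurable unit_lebesgue"
      by (rule symb_comp_measurable) (simp add: measurable_ident_sets)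
    show "(\<lambda>u. ?F (tau M a u)) \<in> borel_measurable unit_lebesgue"
      by (rule measurable_compose[OF tau_measurable F])
  qed
  have tau_push: "tau M a (a * (real k + v)) = v" if "k < M" "0 \<le> v" "v < 1" for k v
    using arg_cong[OF g_push[OF that, of 0 0], of fst] by (simp add: fab_def fa_def split: if_splits)
  have tau_pop: "tau M a (real M * a + (1 - real M * a) * v) = v" if "0 \<le> v" for v
    using arg_cong[OF g_pop[of 0 0 v 0], of fst] that M_pos by (simp add: fab_def fa_def split: if_splits)
  have "(\<integral>\<^sup>+u. w 0 (symb u) * ?F (tau M a u) \<partial>unit_lebesgue)
      = (\<Sum>k<M. ennreal a * (\<integral>\<^sup>+v. w 0 (symb (a * (real k + v))) * ?F (tau M a (a * (real k + v))) \<partial>unit_lebesgue))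
        + ennreal (1 - real M * a) * (\<integral>\<^sup>+v. w 0 (symb (real M * a + (1 - real M * a) * v))
            * ?F (tau M a (real M * a + (1 - real M * a) * v)) \<partial>unit_lebesgue)"
    by (rule nn_integral_unstable[OF G])
  also have "(\<Sum>k<M. ennreal a * (\<integral>\<^sup>+v. w 0 (symb (a * (real k + v))) * ?F (tau M a (a * (real k + v))) \<partial>unit_lebesgue))
      = (\<Sum>k<M. ennreal a * (w 0 (k + 1) * (\<integral>\<^sup>+v. ?F v \<partial>unit_lebesgue)))"
  proof (rule sum.cong[OF refl])
    fix k assume k: "k \<in> {..<M}"
    have "(\<integral>\<^sup>+v. w 0 (symb (a * (real k + v))) * ?F (tau M a (a * (real k + v))) \<partial>unit_lebesgue)
        = (\<integral>\<^sup>+v. w 0 (k + 1) * ?F v \<partial>unit_lebesgue)"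
    proof (rule nn_integral_cong_AE)
      show "AE v in unit_lebesgue. w 0 (symb (a * (real k + v))) * ?F (tau M a (a * (real k + v))) = w 0 (k + 1) * ?F v"
        using AE_unit_lebesgue by eventually_elim (use k in \<open>simp add: symb_push tau_push\<close>)
    qed
    also have "\<dots> = w 0 (k + 1) * (\<integral>\<^sup>+v. ?F v \<partial>unit_lebesgue)"
      by (rule nn_integral_cmult[OF F])
    finally show "ennreal a * (\<integral>\<^sup>+v. w 0 (symb (a * (real k + v))) * ?F (tau M a (a * (real k + v))) \<partial>unit_lebesgue)
        = ennreal a * (w 0 (k + 1) * (\<integral>\<^sup>+v. ?F v \<partial>unit_lebesgue))"
      by simp
  qed
  also have "(\<integral>\<^sup>+v. w 0 (symb (real M * a + (1 - real M * a) * v))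
            * ?F (tau M a (real M * a + (1 - real M * a) * v)) \<partial>unit_lebesgue)
      = (\<integral>\<^sup>+v. w 0 (M + 1) * ?F v \<partial>unit_lebesgue)"
    by (rule nn_integral_cong) (simp add: space_unit_lebesgue symb_pop tau_pop)
  also have "\<dots> = w 0 (M + 1) * (\<integral>\<^sup>+v. ?F v \<partial>unit_lebesgue)"
    by (rule nn_integral_cmult[OF F])
  also have "(\<Sum>k<M. ennreal a * (w 0 (k + 1) * (\<integral>\<^sup>+v. ?F v \<partial>unit_lebesgue)))
      + ennreal (1 - real M * a) * (w 0 (M + 1) * (\<integral>\<^sup>+v. ?F v \<partial>unit_lebesgue))
      = (\<integral>\<^sup>+k. w 0 k \<partial>symbol_measure) * (\<integral>\<^sup>+v. ?F v \<partial>unit_lebesgue)"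
    unfolding nn_integral_symbol by (simp add: distrib_right sum_distrib_right mult.assoc)
  also have "(\<integral>\<^sup>+v. ?F v \<partial>unit_lebesgue) = (\<Prod>n<N. \<integral>\<^sup>+k. w (Suc n) k \<partial>symbol_measure)"
    by (rule Suc.IH)
  finally show ?case
    unfolding eq by (simp only: prod.lessThan_Suc_shift)
qed

text \<open>Invariance under the m-th iterate of \<open>h\<close> moves the window of times into the
  future, where the code is a function of the unstable coordinate.\<close>

lemma nn_integral_code_prod:
  fixes w :: "int \<Rightarrow> nat \<Rightarrow> ennreal"
  assumes "finite J"
  shows "(\<integral>\<^sup>+x. (\<Prod>i\<in>J. w i (code x i)) \<partial>Leb3) = (\<Prod>i\<in>J. \<integral>\<^sup>+k. w i k \<partial>symbol_measure)"
proof -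
  obtain m N :: nat where mN:
    "\<And>f :: int \<Rightarrow> ennreal. (\<Prod>i\<in>J. f i) = (\<Prod>n<N. if int n - int m \<in> J then f (int n - int m) else 1)"
    using prod_int_reindex_nat[OF assms] by blast
  \<comment> \<open>Times outside \<open>J\<close> receive weight 1, whose integral against the
    symbol law is 1.\<close>
  define v where "v n k = (if int n - int m \<in> J then w (int n - int m) k else 1)" for n k
  let ?F = "\<lambda>u. \<Prod>n<N. v n (symb ((tau M a ^^ n) u))"
  have fst_m: "fst \<in> measurable Leb3 unit_lebesgue" unfolding Leb3_eq by simp
  have F: "?F \<in> borel_measurable unit_lebesgue"
    by (intro borel_measurable_prod_ennreal symb_comp_measurable tau_pow_measurable)
  have h: "(h ^^ m) \<in> measurable Leb3 Leb3" "distr Leb3 Leb3 (h ^^ m) = Leb3"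
    using preserves_measure_funpow[OF h_preserves, of m] by (auto simp: preserves_measure_def)
  have "(\<integral>\<^sup>+x. (\<Prod>i\<in>J. w i (code x i)) \<partial>Leb3) = (\<integral>\<^sup>+x. ?F (fst ((h ^^ m) x)) \<partial>Leb3)"
  proof (rule nn_integral_cong_AE)
    show "AE x in Leb3. (\<Prod>i\<in>J. w i (code x i)) = ?F (fst ((h ^^ m) x))"
      using AE_cube
    proof eventually_elim
      case (elim x)
      have "code x (int n - int m) = symb ((tau M a ^^ n) (fst ((h ^^ m) x)))" for n
      proof -
        have "orbit (int n - int m) x = (g ^^ n) ((h ^^ m) x)"
          using orbit_h_pow[OF elim, of "int n" m] by (simp add: orbit_def)
        then show ?thesis by (simp add: code_def fst_g_pow)
      qed
      then show ?case unfolding mN v_def by (intro prod.cong) auto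
    qed
  qed
  also have "\<dots> = (\<integral>\<^sup>+x. ?F (fst x) \<partial>distr Leb3 Leb3 (h ^^ m))"
    by (rule nn_integral_distr[symmetric, OF h(1)]) (use measurable_compose[OF fst_m F] in simp)
  also have "\<dots> = (\<integral>\<^sup>+x. ?F (fst x) \<partial>Leb3)" by (simp only: h(2))
  also have "\<dots> = (\<integral>\<^sup>+u. ?F u \<partial>unit_lebesgue)"
    using unit.emeasure_space_1 by (subst nn_integral_Leb3[OF measurable_compose[OF fst_m F]]) simp
  also have "\<dots> = (\<Prod>n<N. \<integral>\<^sup>+k. v n k \<partial>symbol_measure)"
    by (rule nn_integral_future)
  also have "\<dots> = (\<Prod>i\<in>J. \<integral>\<^sup>+k. w i k \<partial>symbol_measure)"
    unfolding mN v_def using prob_space.emeasure_space_1[OF prob_symbol] by (intro prod.cong) auto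
  finally show ?thesis .
qed

text \<open>A product measure is determined by finite cylinders, whose indicators are products of
  functions of single symbols.\<close>

lemma distr_code: "distr Leb3 \<Omega> code = \<Omega>"
proof -
  interpret S: prob_space symbol_measure by (rule prob_symbol)
  interpret PS: product_prob_space "\<lambda>_::int. symbol_measure" UNIV ..
  show ?thesis
    unfolding bernoulli_measure_def
  proof (rule PS.PiM_eq)
    fix J :: "int set" and A assume J: "finite J" and A: "\<And>j. j \<in> J \<Longrightarrow> A j \<in> sets symbol_measure"
    let ?E = "prod_emb UNIV (\<lambda>_. symbol_measure) J (\<Pi>\<^sub>E j\<in>J. A j)"
    let ?P = "\<Pi>\<^sub>M i\<in>(UNIV::int set). symbol_measure"
    have code: "code \<in> measurable Leb3 ?P"
      using code_measurable by (simp add: bernoulli_measure_def)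
    have E: "?E \<in> sets ?P"
      using J A by (intro sets_PiM_I) auto
    have "emeasure (distr Leb3 ?P code) ?E = (\<integral>\<^sup>+x. indicator ?E (code x) \<partial>Leb3)"
    proof -
      have "emeasure (distr Leb3 ?P code) ?E = (\<integral>\<^sup>+y. indicator ?E y \<partial>distr Leb3 ?P code)"
        using E by simp
      also have "\<dots> = (\<integral>\<^sup>+x. indicator ?E (code x) \<partial>Leb3)"
        by (rule nn_integral_distr[OF code]) (use E in simp)
      finally show ?thesis .
    qed
    also have "\<dots> = (\<integral>\<^sup>+x. (\<Prod>i\<in>J. indicator (A i) (code x i)) \<partial>Leb3)"
    proof (rule nn_integral_cong)
      fix x assume x: "x \<in> space Leb3"
      have "code x \<in> space ?P" using measurable_space[OF code x] .
      then have "code x \<in> ?E \<longleftrightarrow> (\<forall>i\<in>J. code x i \<in> A i)"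
        by (auto simp: prod_emb_def space_PiM)
      then show "(indicator ?E (code x) :: ennreal) = (\<Prod>i\<in>J. indicator (A i) (code x i))"
        using J by (auto simp: indicator_def)
    qed
    also have "\<dots> = (\<Prod>i\<in>J. \<integral>\<^sup>+k. indicator (A i) k \<partial>symbol_measure)"
      by (rule nn_integral_code_prod[OF J])
    also have "\<dots> = (\<Prod>i\<in>J. emeasure symbol_measure (A i))"
      using A by (intro prod.cong) auto
    finally show "emeasure (distr Leb3 ?P code) ?E = (\<Prod>i\<in>J. emeasure symbol_measure (A i))" .
  qed simp
qed

end

section \<open>Decoding under upward drift\<close>

context baker
begin

section \<open>The unstable coordinate from the future\<close>

definition branch :: "nat \<Rightarrow> real \<Rightarrow> real" where
  "branch k y = (if k \<le> M then a * (real k - 1 + y) else real M * a + (1 - real M * a) * y)"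

text \<open>Composes the inverse branches of \<tau> named by the symbols at times 0 to n - 1 and
  applies them to the point 0. The branches contract, so this choice of point is forgotten
  geometrically fast.\<close>

primrec unstable_approx :: "nat \<Rightarrow> (int \<Rightarrow> nat) \<Rightarrow> real" where
  "unstable_approx 0 \<omega> = 0"
| "unstable_approx (Suc n) \<omega> = branch (\<omega> 0) (unstable_approx n (\<lambda>i. \<omega> (i + 1)))"

lemma branch_code:
  assumes "x \<in> cube"
  shows "fst x = branch (code x 0) (fst (g x))"
  using assms
proof (cases rule: cube_cases_forward)
  case (push k u c s)
  then have "code x 0 = k + 1"
    using symb_push[of k u] by (simp add: code_def orbit_def cube_iff)
  then show ?thesis using push by (simp add: branch_def g_push_cube)
next
  case (pop j u c s)
  then have "code x 0 = M + 1"
    using symb_pop[of u] by (simp add: code_def orbit_def cube_iff)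
  then show ?thesis using pop by (simp add: branch_def g_pop_cube)
qed

lemma branch_contracts: "\<bar>branch k y - branch k z\<bar> \<le> max a (1 - real M * a) * \<bar>y - z\<bar>"
proof -
  have "branch k y - branch k z = (if k \<le> M then a else 1 - real M * a) * (y - z)"
    by (simp add: branch_def algebra_simps)
  then show ?thesis
    using a_pos Ma_less by (auto simp: abs_mult intro!: mult_right_mono)
qed

lemma unstable_approx_error:
  "x \<in> cube \<Longrightarrow> \<bar>fst x - unstable_approx n (code x)\<bar> \<le> max a (1 - real M * a) ^ n"
proof (induction n arbitrary: x)
  case 0
  then show ?case by (auto simp: cube_def)
next
  case (Suc n)
  have "\<bar>fst x - unstable_approx (Suc n) (code x)\<bar>
      = \<bar>branch (code x 0) (fst (g x)) - branch (code x 0) (unstable_approx n (code (g x)))\<bar>"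
    using branch_code[OF Suc.prems] code_g[OF Suc.prems] by (simp add: left_shift_def)
  also have "\<dots> \<le> max a (1 - real M * a) * \<bar>fst (g x) - unstable_approx n (code (g x))\<bar>"
    by (rule branch_contracts)
  also have "\<dots> \<le> max a (1 - real M * a) * max a (1 - real M * a) ^ n"
    using Suc.IH[OF g_cube[OF Suc.prems]] a_pos by (intro mult_left_mono) auto
  finally show ?case by simp
qed

lemma unstable_approx_tendsto:
  assumes "x \<in> cube"
  shows "(\<lambda>n. unstable_approx n (code x)) \<longlonglongrightarrow> fst x"
proof -
  have "a < 1" using a_less M_ge_2 by (smt (verit) divide_le_eq_1 of_nat_mono one_le_numeral order_trans of_nat_1)
  then have "(\<lambda>n. max a (1 - real M * a) ^ n) \<longlonglongrightarrow> 0"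
    using a_pos Ma_pos by (intro LIMSEQ_realpow_zero) auto
  then have "(\<lambda>n. unstable_approx n (code x) - fst x) \<longlonglongrightarrow> 0"
    by (rule Lim_null_comparison[rotated])
      (use unstable_approx_error[OF assms] in \<open>simp add: abs_minus_commute\<close>)
  then show ?thesis by (simp add: LIM_zero_iff)
qed

section \<open>The central and stable coordinates from the past\<close>

definition fibre :: "nat \<Rightarrow> real \<times> real \<Rightarrow> real \<times> real" where
  "fibre k p = (if k \<le> M then ((real k - 1 + fst p) / real M, real M * a * snd p)
     else (real M * fst p - real_of_int \<lfloor>real M * fst p\<rfloor>,
           real M * a + b * (real_of_int \<lfloor>real M * fst p\<rfloor> + snd p)))"

text \<open>Starts from p at time -n and arrives at time 0, using the symbols at times -n, ..., -1
  in this order; the recursion peels off the last step.\<close>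

primrec run :: "nat \<Rightarrow> real \<times> real \<Rightarrow> (int \<Rightarrow> nat) \<Rightarrow> real \<times> real" where
  "run 0 p \<omega> = p"
| "run (Suc n) p \<omega> = fibre (\<omega> (- 1)) (run n p (\<lambda>i. \<omega> (i - 1)))"

text \<open>Net number of pushes during the last n steps. For i \<le> n,
  \<open>height n \<omega> - height i \<omega>\<close> is thus the stack level at time -i relative
  to time -n.\<close>

primrec height :: "nat \<Rightarrow> (int \<Rightarrow> nat) \<Rightarrow> int" where
  "height 0 \<omega> = 0"
| "height (Suc n) \<omega> = height n (\<lambda>i. \<omega> (i - 1)) + (if \<omega> (- 1) \<le> M then 1 else - 1)"

lemma run_add: "run (n + m) p \<omega> = run n (run m p (\<lambda>i. \<omega> (i - int n))) \<omega>"
proof (induction n arbitrary: \<omega>)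
  case (Suc n)
  show ?case using Suc[of "\<lambda>i. \<omega> (i - 1)"] by (simp add: algebra_simps)
qed simp

lemma height_le: "height n \<omega> \<le> int n"
proof (induction n arbitrary: \<omega>)
  case (Suc n)
  show ?case using Suc[of "\<lambda>i. \<omega> (i - 1)"] by simp
qed simp

text \<open>One step of g acts on (c, s) through the symbol only: a push puts the named digit on c,
  and a pop moves the leading digit of c into s.\<close>

lemma fibre_code:
  assumes "x \<in> cube"
  shows "snd x = fibre (code x (- 1)) (snd (h x))"
  using assms
proof (cases rule: cube_cases_backward)
  case (push k u c s)
  then have "code x (- 1) = k + 1"
    using symb_push[of k u] by (simp add: code_def orbit_def cube_iff h_push)
  then show ?thesis using push by (simp add: fibre_def h_push)
next
  case (pop j u c s)
  then have "code x (- 1) = M + 1"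
    using symb_pop[of u] by (simp add: code_def orbit_def cube_iff h_pop)
  moreover have "\<lfloor>real M * ((real j + c) / real M)\<rfloor> = int j"
    using M_pos pop by (intro floor_unique) (auto simp: cube_iff)
  ultimately show ?thesis using pop M_pos by (simp add: fibre_def h_pop)
qed

lemma run_code: "x \<in> cube \<Longrightarrow> run n (snd ((h ^^ n) x)) (code x) = snd x"
proof (induction n arbitrary: x)
  case (Suc n)
  have "run (Suc n) (snd ((h ^^ Suc n) x)) (code x)
      = fibre (code x (- 1)) (run n (snd ((h ^^ n) (h x))) (code (h x)))"
    using code_h[OF Suc.prems] by (simp add: funpow_swap1)
  also have "\<dots> = snd x"
    using Suc.IH[OF h_cube[OF Suc.prems]] fibre_code[OF Suc.prems] by simp
  finally show ?case .
qed simp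

lemma fibre_range:
  assumes "k \<in> {1..M + 1}" "p \<in> {0..<1} \<times> {0..<1}"
  shows "fibre k p \<in> {0..<1} \<times> {0..<1}"
proof -
  \<comment> \<open>The unstable coordinate 0 is a dummy that makes the cell lemmas for the cube
    applicable.\<close>
  have p: "(0, fst p, snd p) \<in> cube" using assms(2) by (auto simp: cube_def)
  show ?thesis
  proof (cases "k \<le> M")
    case True
    have "(0, (real (k - 1) + fst p) / real M, real M * a * snd p) \<in> cube"
      by (rule cube_push[OF _ p]) (use True assms(1) in auto)
    then show ?thesis using True assms(1) by (simp add: fibre_def cube_iff of_nat_diff)
  next
    case False
    obtain j d where j: "j < M" "0 \<le> d" "d < 1" "fst p = (real j + d) / real M"
      using grid_cases[of "fst p"] assms(2) by (auto simp: mem_Times_iff)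
    have "\<lfloor>real M * fst p\<rfloor> = int j"
      using M_pos j by (intro floor_unique) auto
    moreover have "(0, d, real M * a + b * (real j + snd p)) \<in> cube"
      by (rule cube_pop) (use j p in \<open>auto simp: cube_iff\<close>)
    moreover have "real M * fst p = real j + d" using j M_pos by simp
    ultimately show ?thesis using False by (simp add: fibre_def cube_iff)
  qed
qed

lemma run_range:
  assumes "\<And>i. \<omega> i \<in> {1..M + 1}" "p \<in> {0..<1} \<times> {0..<1}"
  shows "run n p \<omega> \<in> {0..<1} \<times> {0..<1}"
  using assms(1)
proof (induction n arbitrary: \<omega>)
  case 0
  then show ?case using assms(2) by simp
next
  case (Suc n)
  have "run n p (\<lambda>i. \<omega> (i - 1)) \<in> {0..<1} \<times> {0..<1}"
    using Suc.prems by (intro Suc.IH)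
  then show ?case using fibre_range[OF Suc.prems] by simp
qed

text \<open>The central coordinate is a stack of base \<open>M\<close> digits. If the stack never drops below its
  initial level during a run, then the digits pushed since then do not depend on the initial point.\<close>

lemma run_agree:
  assumes "\<And>i. \<omega> i \<in> {1..M + 1}" "\<And>i. i \<le> n \<Longrightarrow> height i \<omega> \<le> height n \<omega>"
    and "p \<in> {0..<1} \<times> {0..<1}" "p' \<in> {0..<1} \<times> {0..<1}"
  shows "\<lfloor>real M ^ nat (height n \<omega>) * fst (run n p \<omega>)\<rfloor> = \<lfloor>real M ^ nat (height n \<omega>) * fst (run n p' \<omega>)\<rfloor>
    \<and> \<bar>snd (run n p \<omega>) - snd (run n p' \<omega>)\<bar> \<le> max (real M * a) b ^ n"
  using assms(1,2)
proof (induction n arbitrary: \<omega>)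
  case 0
  have "\<lfloor>fst p\<rfloor> = 0" "\<lfloor>fst p'\<rfloor> = 0"
    using assms(3,4) by (auto simp: mem_Times_iff intro!: floor_unique)
  then show ?case using assms(3,4) by (auto simp: mem_Times_iff)
next
  case (Suc n)
  let ?\<sigma> = "\<lambda>i. \<omega> (i - 1)"
  let ?\<mu> = "max (real M * a) b"
  let ?r = "run n p ?\<sigma>" and ?r' = "run n p' ?\<sigma>"
  define d where "d = nat (height n ?\<sigma>)"
  \<comment> \<open>Both heights lose the contribution of the last symbol, so the condition on
    levels passes to the shifted sequence.\<close>
  have le: "height i ?\<sigma> \<le> height n ?\<sigma>" if "i \<le> n" for i
    using Suc.prems(2)[of "Suc i"] that by simp
  have d0: "0 \<le> height n ?\<sigma>" using le[of 0] by simp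
  have IH: "\<lfloor>real M ^ d * fst ?r\<rfloor> = \<lfloor>real M ^ d * fst ?r'\<rfloor>" "\<bar>snd ?r - snd ?r'\<bar> \<le> ?\<mu> ^ n"
    using Suc.IH[of ?\<sigma>] Suc.prems(1) le unfolding d_def by blast+
  have mu: "\<bar>l * (snd ?r - snd ?r')\<bar> \<le> ?\<mu> ^ Suc n" if "0 \<le> l" "l \<le> ?\<mu>" for l
    using that IH(2) by (auto simp: abs_mult intro!: mult_mono)
  show ?case
  proof (cases "\<omega> (- 1) \<le> M")
    case True
    have ht: "nat (height (Suc n) \<omega>) = Suc d"
      using True d0 by (simp add: d_def nat_add_distrib)
    \<comment> \<open>A push puts its digit in front of the d known ones: the prefix, read as an
      integer, grows by (k - 1) M ^ d.\<close>
    have fl: "\<lfloor>real M ^ Suc d * ((real k - 1 + c) / real M)\<rfloor> = int M ^ d * (int k - 1) + \<lfloor>real M ^ d * c\<rfloor>" for k c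
    proof -
      have "real M ^ Suc d * ((real k - 1 + c) / real M) = real_of_int (int M ^ d * (int k - 1)) + real M ^ d * c"
        using M_pos by (simp add: field_simps)
      then show ?thesis by (metis add.commute floor_add_int)
    qed
    have "\<bar>real M * a * (snd ?r - snd ?r')\<bar> \<le> ?\<mu> ^ Suc n"
      by (rule mu) (use Ma_pos in auto)
    then show ?thesis
      unfolding ht using True IH(1) fl by (simp add: fibre_def right_diff_distrib)
  next
    case False
    have "0 \<le> height (Suc n) \<omega>" using Suc.prems(2)[of 0] by simp
    \<comment> \<open>The level is still nonnegative after the pop, so a digit pushed during the run
      is on the stack. Both runs pop this same digit, hence the stable coordinates undergo the same
      affine map.\<close>
    then have "1 \<le> height n ?\<sigma>" using False by simp
    then obtain e where e: "d = Suc e" "nat (height (Suc n) \<omega>) = e"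
      using False by (cases d) (auto simp: d_def nat_diff_distrib)
    have div: "\<lfloor>real M * c\<rfloor> = \<lfloor>real M ^ d * c\<rfloor> div int (M ^ e)" for c
    proof -
      have "real M * c = (real M ^ d * c) / real_of_int (int (M ^ e))"
        using M_pos e by simp
      then show ?thesis by (metis floor_divide_real_eq_div of_nat_0_le_iff)
    qed
    have fl: "\<lfloor>real M ^ e * (real M * c - real_of_int j)\<rfloor> = \<lfloor>real M ^ d * c\<rfloor> - int M ^ e * j" for c j
    proof -
      have "real M ^ e * (real M * c - real_of_int j) = real M ^ d * c - real_of_int (int M ^ e * j)"
        using e by (simp add: algebra_simps)
      then show ?thesis by (metis floor_diff_of_int)
    qed
    have j: "\<lfloor>real M * fst ?r\<rfloor> = \<lfloor>real M * fst ?r'\<rfloor>"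
      unfolding div IH(1) ..
    have "\<bar>b * (snd ?r - snd ?r')\<bar> \<le> ?\<mu> ^ Suc n"
      by (rule mu) (use b_pos in auto)
    then have "\<bar>snd (run (Suc n) p \<omega>) - snd (run (Suc n) p' \<omega>)\<bar> \<le> ?\<mu> ^ Suc n"
      using False j by (simp add: fibre_def right_diff_distrib distrib_left)
    moreover have "\<lfloor>real M ^ e * fst (run (Suc n) p \<omega>)\<rfloor> = \<lfloor>real M ^ e * fst (run (Suc n) p' \<omega>)\<rfloor>"
      using False IH(1) fl j by (simp add: fibre_def)
    ultimately show ?thesis unfolding e(2) by blast
  qed
qed

text \<open>At the least n with height at least d all smaller indices have height below d, so
  \<open>run_agree\<close> applies to the last n steps. Every longer run ends with these steps, as
  does the true orbit, so the error is small from n on and not only along a subsequence.\<close>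

lemma run_tendsto:
  assumes x: "x \<in> cube" and unb: "\<And>D. \<exists>n. D \<le> height n (code x)"
  shows "(\<lambda>n. fst (run n (0, 0) (code x))) \<longlonglongrightarrow> fst (snd x)"
    and "(\<lambda>n. snd (run n (0, 0) (code x))) \<longlonglongrightarrow> snd (snd x)"
proof -
  let ?\<mu> = "max (real M * a) b"
  have mu: "0 \<le> ?\<mu>" "?\<mu> < 1"
    using Ma_pos Ma_less a_pos a_less b_pos M_ge_2 unfolding b_def
    by (auto simp: max_def) (smt (verit) divide_le_eq_1 of_nat_mono one_le_numeral order_trans of_nat_1)
  have approx: "\<exists>n. \<forall>N\<ge>n. \<bar>fst (run N (0, 0) (code x)) - fst (snd x)\<bar> \<le> (1 / 2) ^ d
      \<and> \<bar>snd (run N (0, 0) (code x)) - snd (snd x)\<bar> \<le> ?\<mu> ^ d" for d :: nat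
  proof -
    define n where "n = (LEAST n. int d \<le> height n (code x))"
    have n: "int d \<le> height n (code x)"
      unfolding n_def using unb[of "int d"] by (rule LeastI_ex)
    have le: "height i (code x) \<le> height n (code x)" if "i \<le> n" for i
    proof (cases "i = n")
      case False
      then have "i < n" using that by simp
      then have "\<not> int d \<le> height i (code x)" unfolding n_def by (rule not_less_Least)
      then show ?thesis using n by simp
    qed simp
    \<comment> \<open>Height d takes at least d steps, so the stable error bound in n yields one in
      d.\<close>
    have dn: "d \<le> n" using n height_le[of n "code x"] by simp
    have "\<bar>fst (run N (0, 0) (code x)) - fst (snd x)\<bar> \<le> (1 / 2) ^ d
      \<and> \<bar>snd (run N (0, 0) (code x)) - snd (snd x)\<bar> \<le> ?\<mu> ^ d" if "n \<le> N" for N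
    proof -
      define p where "p = run (N - n) (0, 0) (\<lambda>i. code x (i - int n))"
      define p' where "p' = snd ((h ^^ n) x)"
      have rN: "run N (0, 0) (code x) = run n p (code x)"
        using run_add[of n "N - n" "(0, 0)" "code x"] that by (simp add: p_def)
      have rx: "snd x = run n p' (code x)"
        using run_code[OF x] by (simp add: p'_def)
      have p: "p \<in> {0..<1} \<times> {0..<1}"
        unfolding p_def using code_range[OF x] by (intro run_range) auto
      have p': "p' \<in> {0..<1} \<times> {0..<1}"
        using h_pow_cube[OF x, of n] by (auto simp: p'_def cube_def)
      define K where "K = real M ^ nat (height n (code x))"
      have agree: "\<lfloor>K * fst (run n p (code x))\<rfloor> = \<lfloor>K * fst (run n p' (code x))\<rfloor>"
          "\<bar>snd (run n p (code x)) - snd (run n p' (code x))\<bar> \<le> ?\<mu> ^ n"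
        using run_agree[OF code_range[OF x] le p p'] by (auto simp: K_def)
      \<comment> \<open>At least d leading digits agree, and M \<ge> 2 turns this into an error of
        at most (1 / 2) ^ d.\<close>
      have "(2::real) ^ d \<le> 2 ^ nat (height n (code x))"
        using n by (intro power_increasing) auto
      also have "\<dots> \<le> K"
        unfolding K_def using M_ge_2 by (intro power_mono) auto
      finally have K: "2 ^ d \<le> K" .
      then have K0: "0 < K" by (rule less_le_trans[rotated]) simp
      have "\<bar>K * fst (run n p (code x)) - K * fst (run n p' (code x))\<bar> \<le> 1"
        using agree(1) by linarith
      then have "K * \<bar>fst (run n p (code x)) - fst (run n p' (code x))\<bar> \<le> 1"
        using K0 by (simp add: abs_mult right_diff_distrib[symmetric])
      then have "\<bar>fst (run n p (code x)) - fst (run n p' (code x))\<bar> \<le> 1 / K"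
        using K0 by (simp add: field_simps)
      also have "\<dots> \<le> (1 / 2) ^ d"
        using K by (simp add: power_one_over frac_le)
      finally have 1: "\<bar>fst (run n p (code x)) - fst (run n p' (code x))\<bar> \<le> (1 / 2) ^ d" .
      have "?\<mu> ^ n \<le> ?\<mu> ^ d"
        using mu dn by (intro power_decreasing) auto
      then show ?thesis
        unfolding rN using 1 agree(2) rx by simp
    qed
    then show ?thesis by blast
  qed
  have lim: "f \<longlonglongrightarrow> L" if l: "0 \<le> l" "l < 1" "\<And>d. \<exists>n. \<forall>N\<ge>n. \<bar>f N - L\<bar> \<le> l ^ d" for f :: "nat \<Rightarrow> real" and L l
  proof (rule LIMSEQ_I)
    fix r :: real assume "0 < r"
    then obtain d where "l ^ d < r" using l(2) real_arch_pow_inv by blast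
    then show "\<exists>n0. \<forall>n\<ge>n0. norm (f n - L) < r" using l(3)[of d] by force
  qed
  show "(\<lambda>n. fst (run n (0, 0) (code x))) \<longlonglongrightarrow> fst (snd x)"
    by (rule lim[of "1 / 2"]) (use approx in \<open>auto, blast\<close>)
  show "(\<lambda>n. snd (run n (0, 0) (code x))) \<longlonglongrightarrow> snd (snd x)"
    by (rule lim[of ?\<mu>]) (use approx mu in \<open>blast+\<close>)
qed

text \<open>The truncation to \<open>[0, 1]\<close> matters only where a limit fails to exist and \<open>lim\<close> is arbitrary.\<close>

definition decode :: "(int \<Rightarrow> nat) \<Rightarrow> real \<times> real \<times> real" where
  "decode \<omega> = (max 0 (min 1 (lim (\<lambda>n. unstable_approx n \<omega>))),
     max 0 (min 1 (lim (\<lambda>n. fst (run n (0, 0) \<omega>)))), max 0 (min 1 (lim (\<lambda>n. snd (run n (0, 0) \<omega>)))))"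

lemma decode_code:
  assumes "x \<in> cube" "\<And>D. \<exists>n. D \<le> height n (code x)"
  shows "decode (code x) = x"
  using assms limI[OF unstable_approx_tendsto[OF assms(1)]] limI[OF run_tendsto(1)[OF assms]]
    limI[OF run_tendsto(2)[OF assms]]
  by (cases x) (auto simp: decode_def cube_iff)

lemma decode_measurable: "decode \<in> measurable \<Omega> Leb3"
proof -
  have [measurable]: "(\<lambda>\<omega>. unstable_approx n \<omega>) \<in> borel_measurable \<Omega>" for n
  proof (induction n)
    case (Suc n)
    have [measurable]: "(\<lambda>\<omega>. unstable_approx n (\<lambda>i. \<omega> (i + 1))) \<in> borel_measurable \<Omega>"
      by (rule measurable_compose[OF measurable_reindex Suc])
    show ?case unfolding unstable_approx.simps branch_def by measurable
  qed simp
  have run: "(\<lambda>\<omega>. fst (run n p \<omega>)) \<in> borel_measurable \<Omega> \<and> (\<lambda>\<omega>. snd (run n p \<omega>)) \<in> borel_measurable \<Omega>" for n p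
  proof (induction n)
    case (Suc n)
    have [measurable]: "(\<lambda>\<omega>. fst (run n p (\<lambda>i. \<omega> (i - 1)))) \<in> borel_measurable \<Omega>"
      "(\<lambda>\<omega>. snd (run n p (\<lambda>i. \<omega> (i - 1)))) \<in> borel_measurable \<Omega>"
      using measurable_compose[OF measurable_reindex conjunct1[OF Suc]]
        measurable_compose[OF measurable_reindex conjunct2[OF Suc]] by auto
    show ?case unfolding run.simps fibre_def if_distrib fst_conv snd_conv by (intro conjI; measurable)
  qed simp
  have [measurable]: "(\<lambda>\<omega>. fst (run n p \<omega>)) \<in> borel_measurable \<Omega>"
      "(\<lambda>\<omega>. snd (run n p \<omega>)) \<in> borel_measurable \<Omega>" for n p
    using run by auto
  have "decode \<in> measurable \<Omega> (borel \<Otimes>\<^sub>M borel \<Otimes>\<^sub>M borel)"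
    unfolding decode_def by measurable
  then show ?thesis
    unfolding Leb3_def borel_prod
    by (intro measurable_restrict_space2) (auto simp: decode_def)
qed

lemma height_eq: "height n \<omega> = (\<Sum>i=1..n. if \<omega> (- int i) \<le> M then 1 else - 1)"
proof (induction n arbitrary: \<omega>)
  case (Suc n)
  have e: "- int (Suc i) = - int i - 1" for i by simp
  have "(\<Sum>i=1..Suc n. if \<omega> (- int i) \<le> M then 1 else - 1 :: int)
      = (if \<omega> (- 1) \<le> M then 1 else - 1) + (\<Sum>i=Suc 1..Suc n. if \<omega> (- int i) \<le> M then 1 else - 1)"
    by (subst sum.atLeast_Suc_atMost) auto
  also have "(\<Sum>i=Suc 1..Suc n. if \<omega> (- int i) \<le> M then 1 else - 1 :: int)
      = (\<Sum>i=1..n. if \<omega> (- int i - 1) \<le> M then 1 else - 1)"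
    by (subst sum.shift_bounds_cl_Suc_ivl) (simp only: e)
  finally show ?case using Suc[of "\<lambda>i. \<omega> (i - 1)"] by simp
qed simp

text \<open>Exponential Chebyshev bound: with \<open>r = sqrt ((1 - p) / p)\<close>, where \<open>p = M a > 1 / 2\<close> is the
  probability of a push, the expectation of \<open>r ^ height n\<close> is \<open>(2 sqrt (p (1 - p))) ^ n\<close>.\<close>

lemma AE_height_unbounded:
  assumes drift: "1 / 2 < real M * a"
  shows "AE x in Leb3. \<forall>D. \<exists>n. D \<le> height n (code x)"
proof -
  define p where "p = real M * a"
  have p: "1 / 2 < p" "p < 1" using drift Ma_less by (auto simp: p_def)
  define r where "r = sqrt ((1 - p) / p)"
  have r: "0 < r" "r < 1" using p by (auto simp: r_def)
  have r2: "r\<^sup>2 = (1 - p) / p" using p by (simp add: r_def)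
  define \<theta> where "\<theta> = p * r + (1 - p) / r"
  \<comment> \<open>The value of \<open>r\<close> makes the two summands p r and (1 - p) / r equal,
    which minimises their sum.\<close>
  have theta_eq: "\<theta> = 2 * p * r"
  proof -
    have "1 - p = p * r\<^sup>2" using r2 p by simp
    then show ?thesis using r by (simp add: \<theta>_def power2_eq_square)
  qed
  have theta: "0 < \<theta>" "\<theta> < 1"
  proof -
    show "0 < \<theta>" using theta_eq p r by simp
    have "\<theta>\<^sup>2 = 4 * p * (p * r\<^sup>2)"
      by (simp add: theta_eq power2_eq_square)
    also have "\<dots> = 4 * p * (1 - p)"
      using p by (simp add: r2)
    also have "\<dots> = 1 - (2 * p - 1)\<^sup>2" by (simp add: power2_eq_square algebra_simps)
    also have "\<dots> < 1" using p by simp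
    finally show "\<theta> < 1" by (simp add: power2_less_1_iff abs_less_iff)
  qed
  define w :: "nat \<Rightarrow> ennreal" where "w k = ennreal (if k \<le> M then r else 1 / r)" for k
  have int_w: "(\<integral>\<^sup>+k. w k \<partial>symbol_measure) = ennreal \<theta>"
  proof -
    have "(\<integral>\<^sup>+k. w k \<partial>symbol_measure) = (\<Sum>k<M. ennreal (a * r)) + ennreal ((1 - p) * (1 / r))"
      unfolding nn_integral_symbol using a_pos r p
      by (simp add: w_def ennreal_mult[symmetric] p_def)
    also have "\<dots> = ennreal (real M * (a * r)) + ennreal ((1 - p) * (1 / r))"
      using a_pos r by (simp add: ennreal_mult ennreal_of_nat_eq_real_of_nat)
    also have "\<dots> = ennreal (real M * (a * r) + (1 - p) * (1 / r))"
      using a_pos r p by (intro ennreal_plus[symmetric]) auto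
    finally show ?thesis by (simp add: \<theta>_def p_def mult.assoc)
  qed
  have prod_w: "(\<Prod>i\<in>(\<lambda>i. - int i) ` {1..n}. w (\<omega> i)) = ennreal (r powi height n \<omega>)" for n \<omega>
  proof -
    have "(\<Prod>i\<in>(\<lambda>i. - int i) ` {1..n}. w (\<omega> i)) = (\<Prod>i=1..n. w (\<omega> (- int i)))"
      by (subst prod.reindex) (auto simp: inj_on_def)
    also have "\<dots> = ennreal (\<Prod>i=1..n. if \<omega> (- int i) \<le> M then r else 1 / r)"
      unfolding w_def using r by (intro prod_ennreal) auto
    also have "(\<Prod>i=1..n. if \<omega> (- int i) \<le> M then r else 1 / r) = r powi height n \<omega>"
      unfolding height_eq
    proof (induction n)
      case (Suc n)
      then show ?case using r by (simp add: power_int_add power_int_minus divide_inverse)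
    qed simp
    finally show ?thesis .
  qed
  have bound: "AE x in Leb3. \<exists>n. D \<le> height n (code x)" for D
  proof -
    \<comment> \<open>On \<open>B\<close> all heights stay below D, and r < 1 makes r to the power
      of the height at least r to the power D. So the measure of \<open>B\<close>, times the latter,
      is at most \<theta> ^ n for every n and must vanish.\<close>
    define B where "B = {x \<in> space Leb3. \<forall>n. height n (code x) < D}"
    have mh: "(\<lambda>\<omega>. height n \<omega>) \<in> measurable \<Omega> (count_space UNIV)" for n
    proof (induction n)
      case (Suc n)
      have "(\<lambda>\<omega>. height n (\<lambda>i. \<omega> (i - 1))) \<in> measurable \<Omega> (count_space UNIV)"
        by (rule measurable_compose[OF measurable_reindex Suc])
      moreover have "(\<lambda>\<omega>. \<omega> (- 1)) \<in> measurable \<Omega> (count_space UNIV)"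
        by (rule measurable_Omega_coord_count)
      then have "(\<lambda>\<omega>. if \<omega> (- 1) \<le> M then 1 else - 1 :: int) \<in> measurable \<Omega> (count_space UNIV)"
        by (rule measurable_compose) simp
      ultimately show ?case by simp
    qed simp
    have [measurable]: "(\<lambda>x. height n (code x)) \<in> measurable Leb3 (count_space UNIV)" for n
      by (rule measurable_compose[OF code_measurable mh])
    have B[measurable]: "B \<in> sets Leb3" unfolding B_def by measurable
    have "ennreal (r powi D) * emeasure Leb3 B \<le> ennreal (\<theta> ^ n)" for n
    proof -
      have "ennreal (r powi D) * emeasure Leb3 B = (\<integral>\<^sup>+x. ennreal (r powi D) * indicator B x \<partial>Leb3)"
        by (rule nn_integral_cmult_indicator[symmetric]) (rule B)
      also have "\<dots> \<le> (\<integral>\<^sup>+x. (\<Prod>i\<in>(\<lambda>i. - int i) ` {1..n}. w (code x i)) \<partial>Leb3)"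
      proof (rule nn_integral_mono)
        fix x assume "x \<in> space Leb3"
        have "r powi D \<le> r powi height n (code x)" if "x \<in> B"
        proof -
          have "height n (code x) \<le> D" using that by (auto simp: B_def intro: less_imp_le)
          then show ?thesis using r by (intro power_int_decreasing) auto
        qed
        then show "ennreal (r powi D) * indicator B x \<le> (\<Prod>i\<in>(\<lambda>i. - int i) ` {1..n}. w (code x i))"
          unfolding prod_w by (auto simp: indicator_def intro: ennreal_leI)
      qed
      also have "\<dots> = (\<Prod>i\<in>(\<lambda>i. - int i) ` {1..n}. ennreal \<theta>)"
        by (subst nn_integral_code_prod) (simp, simp only: int_w)
      also have "\<dots> = ennreal (\<theta> ^ n)"
        using theta by (simp add: card_image inj_on_def ennreal_power)
      finally show ?thesis .
    qed
    moreover have "(\<lambda>n. ennreal (\<theta> ^ n)) \<longlonglongrightarrow> ennreal 0"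
      using theta by (intro tendsto_ennrealI LIMSEQ_realpow_zero) auto
    ultimately have "ennreal (r powi D) * emeasure Leb3 B \<le> 0"
      by (intro LIMSEQ_le_const[of "\<lambda>n. ennreal (\<theta> ^ n)"]) auto
    then have "emeasure Leb3 B = 0"
      using zero_less_power_int[OF r(1), of D] by (simp add: ennreal_eq_0_iff)
    then show ?thesis
      by (subst AE_iff_measurable[OF B]) (auto simp: B_def not_le)
  qed
  then show ?thesis by (simp add: AE_all_countable)
qed

lemma bernoulli_code_g:
  assumes "1 / 2 < real M * a"
  shows "bernoulli_code (M + 1) q Leb3 g code decode"
proof (intro bernoulli_code.intro bernoulli_space_axioms bernoulli_code_axioms.intro
    g_preserves code_measurable decode_measurable distr_code)
  show "AE x in Leb3. decode (code x) = x"
    using AE_cube AE_height_unbounded[OF assms] by eventually_elim (auto intro: decode_code)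
  show "AE x in Leb3. code (g x) = left_shift (code x)"
    using AE_cube by eventually_elim (rule code_g)
qed

end

section \<open>Time reversal\<close>

lemma nn_integral_unit_flip:
  assumes G: "G \<in> borel_measurable unit_lebesgue"
  shows "(\<integral>\<^sup>+y. G (1 - y) \<partial>unit_lebesgue) = (\<integral>\<^sup>+x. G x \<partial>unit_lebesgue)"
proof -
  define H where "H x = G x * indicator {0..1} x" for x
  have H: "H \<in> borel_measurable borel"
    using G borel_measurable_restrict_space_iff_ennreal[of "{0..1}" lborel G] by (simp add: H_def[abs_def])
  have "(\<integral>\<^sup>+x. G x \<partial>unit_lebesgue) = (\<integral>\<^sup>+x. H x \<partial>lborel)"
    by (subst nn_integral_restrict_space) (auto simp: H_def[abs_def])
  also have "\<dots> = (\<integral>\<^sup>+y. H (1 - y) \<partial>lborel)"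
    using nn_integral_real_affine[OF H, of "-1" 1] by simp
  also have "\<dots> = (\<integral>\<^sup>+y. G (1 - y) * indicator {0..1} y \<partial>lborel)"
    by (rule nn_integral_cong) (auto simp: H_def split: split_indicator)
  also have "\<dots> = (\<integral>\<^sup>+y. G (1 - y) \<partial>unit_lebesgue)"
    by (subst nn_integral_restrict_space) auto
  finally show ?thesis ..
qed

definition time_reversal :: "real \<times> real \<times> real \<Rightarrow> real \<times> real \<times> real" where
  "time_reversal = (\<lambda>(u, c, s). (1 - s, 1 - c, 1 - u))"

lemma time_reversal_measurable: "time_reversal \<in> measurable Leb3 Leb3"
proof (rule measurable_Leb3I)
  show "time_reversal \<in> borel_measurable borel"
    unfolding time_reversal_def borel_prod[symmetric] split_beta' by measurable
qed (auto simp: time_reversal_def)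

text \<open>Reflections of single coordinates preserve length, and u and s are exchanged by three
  swaps of neighbouring integrals.\<close>

lemma time_reversal_preserves: "preserves_measure Leb3 time_reversal"
proof (rule preserves_Leb3I[OF time_reversal_measurable])
  fix F :: "real \<times> real \<times> real \<Rightarrow> ennreal" assume F: "F \<in> borel_measurable Leb3"
  let ?U = unit_lebesgue
  have [measurable]: "F \<in> borel_measurable (?U \<Otimes>\<^sub>M ?U \<Otimes>\<^sub>M ?U)"
    using F by (simp add: Leb3_eq)
  have flip[measurable]: "(\<lambda>y. 1 - y) \<in> measurable ?U ?U"
    by (rule measurable_restrict_space3) auto
  have flip_space[measurable]: "1 - y \<in> space ?U" if "y \<in> space ?U" for y
    using that by (simp add: space_unit_lebesgue)
  have "(\<integral>\<^sup>+x. F (time_reversal x) \<partial>Leb3) = (\<integral>\<^sup>+u. \<integral>\<^sup>+c. \<integral>\<^sup>+s. F (1 - s, 1 - c, 1 - u) \<partial>?U \<partial>?U \<partial>?U)"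
    by (subst nn_integral_Leb3[OF measurable_compose[OF time_reversal_measurable F]]) (simp add: time_reversal_def)
  also have "\<dots> = (\<integral>\<^sup>+u. \<integral>\<^sup>+c. \<integral>\<^sup>+s. F (1 - s, 1 - c, u) \<partial>?U \<partial>?U \<partial>?U)"
    by (rule nn_integral_unit_flip[where G="\<lambda>u. \<integral>\<^sup>+c. \<integral>\<^sup>+s. F (1 - s, 1 - c, u) \<partial>?U \<partial>?U"]) measurable
  also have "\<dots> = (\<integral>\<^sup>+u. \<integral>\<^sup>+c. \<integral>\<^sup>+s. F (1 - s, c, u) \<partial>?U \<partial>?U \<partial>?U)"
  proof (rule nn_integral_cong)
    fix u assume [measurable]: "u \<in> space ?U"
    show "(\<integral>\<^sup>+c. \<integral>\<^sup>+s. F (1 - s, 1 - c, u) \<partial>?U \<partial>?U) = (\<integral>\<^sup>+c. \<integral>\<^sup>+s. F (1 - s, c, u) \<partial>?U \<partial>?U)"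
      by (rule nn_integral_unit_flip[where G="\<lambda>c. \<integral>\<^sup>+s. F (1 - s, c, u) \<partial>?U"]) measurable
  qed
  also have "\<dots> = (\<integral>\<^sup>+u. \<integral>\<^sup>+c. \<integral>\<^sup>+s. F (s, c, u) \<partial>?U \<partial>?U \<partial>?U)"
  proof (rule nn_integral_cong, rule nn_integral_cong)
    fix u c assume [measurable]: "u \<in> space ?U" "c \<in> space ?U"
    show "(\<integral>\<^sup>+s. F (1 - s, c, u) \<partial>?U) = (\<integral>\<^sup>+s. F (s, c, u) \<partial>?U)"
      by (rule nn_integral_unit_flip[where G="\<lambda>s. F (s, c, u)"]) measurable
  qed
  also have "\<dots> = (\<integral>\<^sup>+u. \<integral>\<^sup>+s. \<integral>\<^sup>+c. F (s, c, u) \<partial>?U \<partial>?U \<partial>?U)"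
  proof (rule nn_integral_cong)
    fix u assume [measurable]: "u \<in> space ?U"
    show "(\<integral>\<^sup>+c. \<integral>\<^sup>+s. F (s, c, u) \<partial>?U \<partial>?U) = (\<integral>\<^sup>+s. \<integral>\<^sup>+c. F (s, c, u) \<partial>?U \<partial>?U)"
      by (rule unit2.Fubini') measurable
  qed
  also have "\<dots> = (\<integral>\<^sup>+s. \<integral>\<^sup>+u. \<integral>\<^sup>+c. F (s, c, u) \<partial>?U \<partial>?U \<partial>?U)"
    by (rule unit2.Fubini') measurable
  also have "\<dots> = (\<integral>\<^sup>+s. \<integral>\<^sup>+c. \<integral>\<^sup>+u. F (s, c, u) \<partial>?U \<partial>?U \<partial>?U)"
  proof (rule nn_integral_cong)
    fix s assume [measurable]: "s \<in> space ?U"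
    show "(\<integral>\<^sup>+u. \<integral>\<^sup>+c. F (s, c, u) \<partial>?U \<partial>?U) = (\<integral>\<^sup>+c. \<integral>\<^sup>+u. F (s, c, u) \<partial>?U \<partial>?U)"
      by (rule unit2.Fubini') measurable
  qed
  also have "\<dots> = (\<integral>\<^sup>+x. F x \<partial>Leb3)"
    by (rule nn_integral_Leb3[OF F, symmetric])
  finally show "(\<integral>\<^sup>+x. F (time_reversal x) \<partial>Leb3) = (\<integral>\<^sup>+x. F x \<partial>Leb3)" .
qed

context baker
begin

text \<open>The factor map is the projection to (u, c), and the fixed point (0, 0) of f_a provides
  the default orbit.\<close>

lemma natural_extension_of_code:
  assumes "bernoulli_code (M + 1) p Leb3 g \<Phi> \<Psi>"
    and "s \<in> measurable Leb2 (point_measure {1..M + 1} (\<lambda>k. ennreal (p k)))"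
    and "AE x in Leb3. \<Phi> x i = s (fst x, fst (snd x))"
  shows "is_bernoulli_natext Leb2 (fa M a) (M + 1) p"
proof (rule bernoulli_code.natural_extension_is_bernoulli[OF assms(1)])
  show "(\<lambda>z. z) \<in> borel_measurable Leb2"
    unfolding Leb2_def by (rule measurable_restrict_space1) simp
  show "(0, 0) \<in> space Leb2" by (simp add: space_Leb2)
  show "fa M a (0, 0) = (0, 0)" using Ma_pos by (simp add: fa_def tau_def)
  show "AE x in Leb3. (fst (g x), fst (snd (g x))) = fa M a (fst x, fst (snd x))"
    by (rule AE_I2) (auto simp: fab_def)
qed (use assms(2,3) fa_preserves measurable_proj_Leb3 distr_Leb3_Leb2 in auto)

lemma bernoulli_if_push_drift:
  assumes "1 / 2 < real M * a"
  shows "is_bernoulli_natext Leb2 (fa M a) (M + 1) q" and "is_bernoulli Leb3 g (M + 1) q"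
proof -
  note code = bernoulli_code_g[OF assms]
  show "is_bernoulli Leb3 g (M + 1) q"
    by (rule bernoulli_code.is_bernoulli[OF code])
  show "is_bernoulli_natext Leb2 (fa M a) (M + 1) q"
  proof (rule natural_extension_of_code[OF code])
    show "(\<lambda>y. symb (fst y)) \<in> measurable Leb2 symbol_measure"
      unfolding Leb2_eq by (rule measurable_compose[OF measurable_fst symb_measurable])
    show "AE x in Leb3. code x 0 = symb (fst (fst x, fst (snd x)))"
      by (rule AE_I2) (simp add: code_def orbit_def)
  qed
qed

text \<open>The parameters a and b sum to 1 / M, so each is the \<open>b\<close> of the other, and M
  b = 1 - M a exceeds 1/2 when M a is below it.\<close>

lemma dual: "baker M b"
  using M_ge_2 b_pos a_pos by unfold_locales (auto simp: b_def)

lemma dual_b: "baker.b M b = a"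
  unfolding baker.b_def[OF dual] by (simp add: b_def)

text \<open>Reflection turns digit k into M - 1 - k and lets the map with parameter b undo a step of
  g: its pops reverse pushes and its pushes reverse pops. By the second equation, the symbol of the
  undoing step depends on (u, c) only, as needed for f_a. The strict inequalities keep 1 - c and 1 -
  s below 1, inside the half-open cells.\<close>

lemma time_reversal_conj:
  assumes x: "x \<in> cube" and pos: "0 < fst (snd x)" "0 < snd (snd x)"
  shows "fab M b a (time_reversal (g x)) = time_reversal x"
    and "baker.symb M b (fst (time_reversal (g x)))
      = (if fst x < real M * a then M + 1 else nat (int M - beta_idx M (fst (snd x))))"
proof -
  interpret D: baker M b by (rule dual)
  have Db: "D.b = a" by (rule dual_b)
  have Mb': "real M * b = 1 - real M * a" by (rule Mb)
  have "fab M b a (time_reversal (g x)) = time_reversal x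
    \<and> D.symb (fst (time_reversal (g x)))
      = (if fst x < real M * a then M + 1 else nat (int M - beta_idx M (fst (snd x))))"
    using x
  proof (cases rule: cube_cases_forward)
    case (push k u c s)
    \<comment> \<open>Chosen from 1 - (k + c) / M = (M - 1 - k + (1 - c)) / M.\<close>
    define j where "j = M - 1 - k"
    have j: "j < M" "real j = real M - 1 - real k" using push(1) by (auto simp: j_def)
    have "g x = (u, (real k + c) / real M, real M * a * s)"
      unfolding push(3) by (rule g_push_cube[OF push(1,2)])
    then have gx: "time_reversal (g x) = (real M * b + (1 - real M * b) * (1 - s), (real j + (1 - c)) / real M, 1 - u)"
      using j M_pos unfolding Mb' by (simp add: time_reversal_def field_simps)
    have r: "0 \<le> 1 - c" "1 - c < 1" "0 \<le> 1 - s"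
      using push pos by (auto simp: cube_iff)
    have "fab M b a (time_reversal (g x)) = (1 - s, 1 - c, real M * b + a * (real j + (1 - u)))"
      unfolding gx using D.g_pop[OF j(1) r, of "1 - u"] by (simp add: Db)
    also have "\<dots> = time_reversal x"
      unfolding push(3) j(2) Mb' by (simp add: time_reversal_def algebra_simps)
    finally have 1: "fab M b a (time_reversal (g x)) = time_reversal x" .
    have "fst x < real M * a"
      using push push_less[of k u] by (simp add: cube_iff)
    then show ?thesis
      using 1 D.symb_pop[OF r(3)] by (simp add: gx)
  next
    case (pop j u c s)
    \<comment> \<open>Chosen from 1 - (M a + b (j + s)) = b (M - 1 - j + (1 - s)).\<close>
    define k where "k = M - 1 - j"
    have k: "k < M" "real k = real M - 1 - real j" "M - j = k + 1" using pop(1) by (auto simp: k_def)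
    have r: "0 \<le> 1 - s" "1 - s < 1"
      using pop pos by (auto simp: cube_iff)
    have "g x = (u, c, real M * a + b * (real j + s))"
      unfolding pop(3) by (rule g_pop_cube[OF pop(1,2)])
    then have gx: "time_reversal (g x) = (b * (real k + (1 - s)), 1 - c, 1 - u)"
      unfolding k(2) using Mb' by (simp add: time_reversal_def algebra_simps)
    have "fab M b a (time_reversal (g x)) = (1 - s, (real k + (1 - c)) / real M, real M * b * (1 - u))"
      unfolding gx using D.g_push[OF k(1) r, of "1 - c" "1 - u"] by (simp add: Db)
    also have "\<dots> = time_reversal x"
      unfolding pop(3) k(2) Mb' using M_pos by (simp add: time_reversal_def field_simps)
    finally have 1: "fab M b a (time_reversal (g x)) = time_reversal x" .
    have "0 \<le> (1 - real M * a) * u"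
      using pop Ma_less by (auto simp: cube_iff)
    then have "\<not> fst x < real M * a" using pop by simp
    moreover have "\<lfloor>real M * fst (snd x)\<rfloor> = int j"
      using pop M_pos by (intro floor_unique) (auto simp: cube_iff)
    then have "nat (int M - beta_idx M (fst (snd x))) = M - j"
      using pop(1) by (simp add: beta_idx_def)
    ultimately show ?thesis
      using 1 D.symb_push[OF k(1) r] k(3) by (simp add: gx)
  qed
  then show "fab M b a (time_reversal (g x)) = time_reversal x"
    "D.symb (fst (time_reversal (g x)))
      = (if fst x < real M * a then M + 1 else nat (int M - beta_idx M (fst (snd x))))"
    by blast+
qed

text \<open>In terms of g the roles of the symbols change: M + 1 now stands for any push, and the
  symbol M - j for the pop of the digit j.\<close>

lemma bernoulli_if_pop_drift:
  assumes "real M * a < 1 / 2"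
  shows "is_bernoulli_natext Leb2 (fa M a) (M + 1) (baker.q M b)"
    and "is_bernoulli Leb3 g (M + 1) (baker.q M b)"
proof -
  interpret D: baker M b by (rule dual)
  have Db: "D.b = a" by (rule dual_b)
  have "1 / 2 < real M * b" using assms Mb by simp
  from D.bernoulli_code_g[OF this] interpret DC: bernoulli_code "M + 1" D.q Leb3 "fab M b a" D.code D.decode
    by (simp only: Db)
  have "AE x in Leb3. x \<in> cube \<and> 0 < fst (snd x) \<and> 0 < snd (snd x)"
    using AE_cube AE_Leb3 by eventually_elim simp
  then have conj: "AE x in Leb3. fab M b a (time_reversal (g x)) = time_reversal x
      \<and> D.symb (fst (time_reversal (g x))) = (if fst x < real M * a then M + 1 else nat (int M - beta_idx M (fst (snd x))))"
    by eventually_elim (auto simp: time_reversal_conj)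
  have rev: "bernoulli_code (M + 1) D.q Leb3 g (\<lambda>x i. D.code (time_reversal x) (- i))
      (\<lambda>\<omega>. time_reversal (D.decode (\<lambda>i. \<omega> (- i))))"
  proof (rule DC.reversed_code[OF g_preserves time_reversal_preserves])
    show "time_reversal (time_reversal x) = x" for x
      by (cases x) (simp add: time_reversal_def)
    show "AE x in Leb3. fab M b a (time_reversal (g x)) = time_reversal x"
      using conj by eventually_elim simp
  qed
  show "is_bernoulli Leb3 g (M + 1) D.q"
    by (rule bernoulli_code.is_bernoulli[OF rev])
  show "is_bernoulli_natext Leb2 (fa M a) (M + 1) D.q"
  proof (rule natural_extension_of_code[OF rev])
    let ?s = "\<lambda>y. if fst y < real M * a then M + 1 else nat (int M - beta_idx M (snd y))"
    have "AE x in Leb3. time_reversal x \<in> cube"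
      using AE_Leb3 by eventually_elim (auto simp: time_reversal_def cube_def)
    then have "AE x in Leb3. time_reversal (g x) \<in> cube"
      by (rule AE_preserves_measure[OF g_preserves])
    \<comment> \<open>The reversed code at time 1 is the dual code of the reflected point at time
      -1. That symbol belongs to the dual step from the reflection of g x to the reflection of x,
      which undoes the step of g at x; hence the offset 1.\<close>
    then show "AE x in Leb3. D.code (time_reversal x) (- 1) = ?s (fst x, fst (snd x))"
      using conj
    proof eventually_elim
      case (elim x)
      have "D.code (fab M b a (time_reversal (g x))) (- 1) = D.code (time_reversal (g x)) 0"
        using D.code_g[OF elim(1)] by (simp add: Db left_shift_def)
      then show ?case
        using elim(2) by (simp add: D.code_def D.orbit_def)
    qed
    have sub: "?s y \<in> {1..M + 1}" if "y \<in> space Leb2" for y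
    proof -
      have "0 \<le> beta_idx M (snd y)" "beta_idx M (snd y) \<le> int M - 1"
        using that M_ge_2 M_pos by (auto simp: beta_idx_def space_Leb2)
      then show ?thesis by auto
    qed
    have "(\<lambda>c. \<lfloor>real M * c\<rfloor>) \<in> measurable borel (count_space UNIV)"
      by (rule measurable_compose[OF _ measurable_real_floor]) simp
    then have "(\<lambda>c. nat (int M - beta_idx M c)) \<in> measurable borel (count_space UNIV)"
      unfolding beta_idx_def by (rule measurable_compose) simp
    then have "?s \<in> measurable (borel \<Otimes>\<^sub>M borel) (count_space UNIV)"
      by (intro measurable_If measurable_compose[OF measurable_snd]) (auto simp: pred_def[symmetric])
    then have "?s \<in> measurable Leb2 (count_space UNIV)"
      unfolding Leb2_def borel_prod by (intro measurable_restrict_space1) simp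
    then show "?s \<in> measurable Leb2 (point_measure {1..M + 1} (\<lambda>k. ennreal (D.q k)))"
      using sub by (auto simp: measurable_count_space_eq2_countable sets_point_measure space_point_measure)
  qed
qed

end

theorem mainTheorem3:
  fixes M :: nat and a :: real
  assumes "M \<ge> 2" and "0 < a" and "a < 1 / real M"
  shows "preserves_measure Leb2 (fa M a)
       \<and> preserves_measure Leb3 (fab M a (1 / real M - a))
       \<and> (a < 1 / (2 * real M) \<longrightarrow>
           is_bernoulli_natext Leb2 (fa M a) (M + 1)
              (\<lambda>k. if k \<le> M then (1 - real M * a) / real M else real M * a)
         \<and> is_bernoulli Leb3 (fab M a (1 / real M - a)) (M + 1)
              (\<lambda>k. if k \<le> M then (1 - real M * a) / real M else real M * a))
       \<and> (1 / (2 * real M) < a \<longrightarrow>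
           is_bernoulli_natext Leb2 (fa M a) (M + 1)
              (\<lambda>k. if k \<le> M then a else 1 - real M * a)
         \<and> is_bernoulli Leb3 (fab M a (1 / real M - a)) (M + 1)
              (\<lambda>k. if k \<le> M then a else 1 - real M * a))"
proof -
  interpret baker M a by (rule baker.intro) (fact assms)+
  have b: "1 / real M - a = b" by (simp add: b_def)
  have q: "(\<lambda>k. if k \<le> M then a else 1 - real M * a) = q"
    by (auto simp: q_def)
  \<comment> \<open>The dual weights are b = (1 - M a) / M on dual pushes and 1 - M b = M a on dual
    pops.\<close>
  have q': "(\<lambda>k. if k \<le> M then (1 - real M * a) / real M else real M * a) = baker.q M b"
  proof
    fix k
    have "(1 - real M * a) / real M = b" using M_pos by (simp add: b_def diff_divide_distrib)
    then show "(if k \<le> M then (1 - real M * a) / real M else real M * a) = baker.q M b k"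
      unfolding baker.q_def[OF dual] using Mb by simp
  qed
  show ?thesis
    unfolding b q q'
  proof (intro conjI impI fa_preserves g_preserves)
    assume "a < 1 / (2 * real M)"
    then have "real M * a < 1 / 2" using M_pos by (simp add: field_simps)
    then show "is_bernoulli_natext Leb2 (fa M a) (M + 1) (baker.q M b)" "is_bernoulli Leb3 g (M + 1) (baker.q M b)"
      by (rule bernoulli_if_pop_drift)+
  next
    assume "1 / (2 * real M) < a"
    then have "1 / 2 < real M * a" using M_pos by (simp add: field_simps)
    then show "is_bernoulli_natext Leb2 (fa M a) (M + 1) q" "is_bernoulli Leb3 g (M + 1) q"
      by (rule bernoulli_if_push_drift)+
  qed
qed

end
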